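(* Let $n\ge1$, let $\sigma\in\mathfrak{S}_n^B$ and let $\mathcal{T}=\zeta^{-1}(\sigma)\in\mathcal{PT}_n^B$. Then $$\ell(\sigma)=\mathrm{inv}(\sigma)=2\{\mathrm{zero}_{EE}(\mathcal{T})+\mathrm{zero}_{NN}(\mathcal{T})\}+\mathrm{one}(\mathcal{T}).$$
   Context: Signed permutations. $[n]=\{1,\dots,n\}$, $[\pm n]=\{\pm1,\dots,\pm n\}$. $\mathfrak{S}_n^B$ is the group of permutations $\sigma$ of $[\pm n]$ with $\sigma(-i)=-\sigma(i)$. It is generated by $s_0$ (which sends $1\mapsto-1$ and fixes $2,\dots,n$) and $s_i$, $1\le i\le n-1$ (which exchanges $i$ and $i+1$). $\ell(\sigma)$ is the least number of generators in an expression of $\sigma$. $\mathrm{inv}(\sigma)$ is the number of pairs $(i,j)\in[n]\times[n]$ with $i<j$ and $\sigma(i)>\sigma(j)$, plus the number of pairs $(i,j)\in[n]\times[n]$ with $i\le j$ and $\sigma(-i)>\sigma(j)$. Diagrams. For $0\le k\le n$, a $(k,n)$-diagram is a left-justified diagram of boxes in a $k\times(n-k)$ rectangle with $\lambda_r$ boxes in row $r$, $\lambda_1\ge\dots\ge\lambda_k\ge0$. A shifted $(k,n)$-diagram is a $(k,n)$-diagram together with a staircase of boxes added above it, the $j$-th column from the left receiving $n-k-j+1$ additional boxes; the topmost box of each column is called a diagonal. Labels: follow the southeast border of the $(k,n)$-diagram from the northeast corner to the southwest corner of the rectangle, labeling its unit steps $1,\dots,n$; a vertical step gives its label to its row, a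 horizontal step gives its label to its column. Each added (staircase) row, whose diagonal (rightmost) box lies in the column labeled $i$, is labeled $-i$. Permutation tableau of type $B$ of length $n$ (set $\mathcal{PT}_n^B$): a $(0,1)$-filling of a shifted $(k,n)$-diagram such that (i) every column contains a $1$; (ii) a box with a $1$ above it in its column and a $1$ to its left in its row contains a $1$; (iii) if a diagonal contains $0$, its row contains no $1$. Zigzag paths and $\zeta$. The zigzag path from a row (column) starts at the left of that row (the top of that column) moving east (south), switches direction between east and south at each $1$ it meets, and stops when it reaches the right end of a row or the bottom of a column. $\zeta:\mathcal{PT}_n^B\to\mathfrak{S}_n^B$ is the (known) bijection such that for $i\in[n]$: if $i$ labels a row, $\zeta(\mathcal{T})(i)$ is the label of the row or column where the path from row $i$ ends; if $-i$ labels a row with $0$ in its diagonal, $\zeta(\mathcal{T})(i)$ is the label where the path from column $i$ ends; if $-i$ labels a row with $1$ in its diagonal, $\zeta(\mathcal{T})(-i)$ is the label where the path from row $-i$ ends. Statistics. Through each box containing $0$ pass exactly two zigzag paths, one vertically and one horizontally. $\mathrm{zero}_{EE}(\mathcal{T})$ (resp. $\mathrm{zero}_{NN}(\mathcal{T})$) is the number of $0$'s for which both of these paths are from rows (resp. both are from columns) of $\mathcal{T}$. $\mathrm{one}(\mathcal{T})$ is the number of $1$'s in $\mathcal{T}$. *)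

theory Defs
  imports "HOL-Combinatorics.Combinatorics"
begin

section \<open>Signed permutations\<close>

definition pm_set :: "nat \<Rightarrow> int set" where
  "pm_set n = {- int n..int n} - {0}"

definition signed_perms :: "nat \<Rightarrow> (int \<Rightarrow> int) set" where
  "signed_perms n = {\<sigma>. \<sigma> permutes pm_set n \<and> (\<forall>i\<in>pm_set n. \<sigma> (- i) = - \<sigma> i)}"

text \<open>As a signed permutation, the generator exchanging \<open>i\<close> and \<open>i + 1\<close> also exchanges
  \<open>- i\<close> and \<open>- (i + 1)\<close>.\<close>

definition sgen :: "nat \<Rightarrow> int \<Rightarrow> int" where
  "sgen i = (if i = 0 then transpose 1 (- 1)
             else transpose (int i) (int i + 1) \<circ> transpose (- int i) (- (int i + 1)))"

definition length_B :: "nat \<Rightarrow> (int \<Rightarrow> int) \<Rightarrow> nat" where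
  "length_B n \<sigma> =
     (LEAST l. \<exists>w. length w = l \<and> set w \<subseteq> {0..<n} \<and> \<sigma> = foldr (\<circ>) (map sgen w) id)"

definition inv_B :: "nat \<Rightarrow> (int \<Rightarrow> int) \<Rightarrow> nat" where
  "inv_B n \<sigma> =
     card {(i, j). i \<in> {1..int n} \<and> j \<in> {1..int n} \<and> i < j \<and> \<sigma> i > \<sigma> j} +
     card {(i, j). i \<in> {1..int n} \<and> j \<in> {1..int n} \<and> i \<le> j \<and> \<sigma> (- i) > \<sigma> j}"


section \<open>Shifted diagrams and fillings\<close>

text \<open>A filled shifted \<open>(k, n)\<close>-diagram consists of the row lengths
  \<open>\<lambda>\<^sub>1, \<dots>, \<lambda>\<^sub>k\<close> (\<open>parts\<close>), the number \<open>n - k\<close> of columns (\<open>width\<close>), and the set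
  \<open>ones\<close> of boxes containing 1; all other boxes contain 0.

  A box is a pair (row, column) of positions, both counted from 1, rows from the top and
  columns from the left. Rows \<open>1, \<dots>, n - k\<close> are the added staircase and row
  \<open>n - k + r\<close> is row \<open>r\<close> of the \<open>(k, n)\<close>-diagram. Column \<open>j\<close> has its \<open>n - k - j + 1\<close>
  additional boxes in rows \<open>j, \<dots>, n - k\<close>, hence its diagonal is the box \<open>(j, j)\<close>.\<close>

record filling =
  parts :: "nat list"
  width :: nat
  ones :: "(nat \<times> nat) set"

definition size_of :: "filling \<Rightarrow> nat" where
  "size_of T = length (parts T) + width T"

definition boxes :: "filling \<Rightarrow> (nat \<times> nat) set" where
  "boxes T = {(i, j). 1 \<le> j \<and> j \<le> i \<and> i \<le> width T} \<union>
             {(width T + r, j) | r j. 1 \<le> r \<and> r \<le> length (parts T) \<and> 1 \<le> j \<and> j \<le> parts T ! (r - 1)}"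

definition zeros :: "filling \<Rightarrow> (nat \<times> nat) set" where
  "zeros T = boxes T - ones T"

definition filled_diagram :: "filling \<Rightarrow> bool" where
  "filled_diagram T \<longleftrightarrow>
     sorted_wrt (\<ge>) (parts T) \<and> (\<forall>p\<in>set (parts T). p \<le> width T) \<and> ones T \<subseteq> boxes T"

text \<open>A label is 1 plus the number of border steps preceding the given step. The vertical step
  of row \<open>r\<close> of the \<open>(k, n)\<close>-diagram comes after \<open>r - 1\<close> vertical steps and the
  \<open>n - k - \<lambda>\<^sub>r\<close> horizontal steps to its right. The horizontal step of column \<open>j\<close>
  comes after the \<open>n - k - j\<close> horizontal steps of the columns to its right and the vertical
  steps of the rows \<open>r\<close> that reach column \<open>j\<close>.\<close>

definition col_label :: "filling \<Rightarrow> nat \<Rightarrow> int" where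
  "col_label T j =
     1 + (int (width T) - int j) + int (card {r \<in> {1..length (parts T)}. j \<le> parts T ! (r - 1)})"

definition row_label :: "filling \<Rightarrow> nat \<Rightarrow> int" where
  "row_label T i =
     (if i \<le> width T then - col_label T i
      else let r = i - width T in
        1 + (int r - 1) + (int (width T) - int (parts T ! (r - 1))))"

definition PT_B :: "nat \<Rightarrow> filling set" where
  "PT_B n = {T. filled_diagram T \<and> size_of T = n \<and>
     (\<forall>j\<in>{1..width T}. \<exists>i. (i, j) \<in> ones T) \<and>
     (\<forall>(i, j)\<in>boxes T. (\<exists>i'<i. (i', j) \<in> ones T) \<and> (\<exists>j'<j. (i, j') \<in> ones T)
        \<longrightarrow> (i, j) \<in> ones T) \<and>
     (\<forall>d\<in>{1..width T}. (d, d) \<notin> ones T \<longrightarrow> (\<forall>j. (d, j) \<notin> ones T))}"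


section \<open>Zigzag paths\<close>

datatype dir = East | South

fun turn :: "dir \<Rightarrow> dir" where
  "turn East = South"
| "turn South = East"

fun step :: "dir \<Rightarrow> nat \<times> nat \<Rightarrow> nat \<times> nat" where
  "step East (i, j) = (i, j + 1)"
| "step South (i, j) = (i + 1, j)"

lemma finite_boxes: "finite (boxes T)"
proof -
  have "boxes T \<subseteq> {..size_of T} \<times> {..width T + sum_list (parts T)}"
  proof (clarsimp simp: boxes_def size_of_def, safe)
    fix r j
    assume "Suc 0 \<le> r" "r \<le> length (parts T)" "j \<le> parts T ! (r - Suc 0)"
    moreover from this have "parts T ! (r - Suc 0) \<le> sum_list (parts T)"
      by (intro member_le_sum_list nth_mem) auto
    ultimately show "j \<le> width T + sum_list (parts T)" by linarith
  qed auto
  then show ?thesis by (rule finite_subset) auto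
qed

text \<open>\<open>zigzag T d b\<close> lists the positions of the zigzag path that enters position \<open>b\<close> travelling
  in direction \<open>d\<close>; each position is paired with the direction in which it is entered. The last
  entry is the first position outside the diagram: the path ends at the right end of its row if
  that position is entered eastwards, and at the bottom of its column if it is entered
  southwards. (A row without boxes gives a path consisting of this last entry only.)\<close>

function zigzag :: "filling \<Rightarrow> dir \<Rightarrow> nat \<times> nat \<Rightarrow> (dir \<times> nat \<times> nat) list" where
  "zigzag T d b =
     (d, b) # (if b \<in> boxes T
               then let d' = (if b \<in> ones T then turn d else d) in zigzag T d' (step d' b)
               else [])"
  by auto
termination
proof (relation "measure (\<lambda>(T, d, b). card {c \<in> boxes T. fst b \<le> fst c \<and> snd b \<le> snd c})",
    goal_cases)
  case 1
  show ?case by simp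
next
  case (2 T d b d')
  have "{c \<in> boxes T. fst (step d' b) \<le> fst c \<and> snd (step d' b) \<le> snd c}
      \<subseteq> {c \<in> boxes T. fst b \<le> fst c \<and> snd b \<le> snd c} - {b}"
    by (cases b; cases d') auto
  moreover have "b \<in> {c \<in> boxes T. fst b \<le> fst c \<and> snd b \<le> snd c}"
    using 2(1) by simp
  ultimately have "{c \<in> boxes T. fst (step d' b) \<le> fst c \<and> snd (step d' b) \<le> snd c}
      \<subset> {c \<in> boxes T. fst b \<le> fst c \<and> snd b \<le> snd c}"
    by blast
  then show ?case
    by (auto intro!: psubset_card_mono finite_subset[OF _ finite_boxes])
qed

declare zigzag.simps [simp del]

definition row_path :: "filling \<Rightarrow> nat \<Rightarrow> (dir \<times> nat \<times> nat) list" where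
  "row_path T i = zigzag T East (i, 1)"

definition col_path :: "filling \<Rightarrow> nat \<Rightarrow> (dir \<times> nat \<times> nat) list" where
  "col_path T j = zigzag T South (j, j)"

definition end_label :: "filling \<Rightarrow> (dir \<times> nat \<times> nat) list \<Rightarrow> int" where
  "end_label T p = (case last p of
      (East, i, j) \<Rightarrow> row_label T i
    | (South, i, j) \<Rightarrow> col_label T j)"

definition row_with_label :: "filling \<Rightarrow> int \<Rightarrow> nat" where
  "row_with_label T l = (THE i. i \<in> {1..size_of T} \<and> row_label T i = l)"

definition col_with_label :: "filling \<Rightarrow> int \<Rightarrow> nat" where
  "col_with_label T l = (THE j. j \<in> {1..width T} \<and> col_label T j = l)"

text \<open>The values of \<open>\<zeta>(T)\<close> on \<open>[n]\<close>; if \<open>- l\<close> labels a row, its diagonal is the diagonal of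
  the column labeled \<open>l\<close>.\<close>

definition zeta_pos :: "filling \<Rightarrow> int \<Rightarrow> int" where
  "zeta_pos T l =
     (if l \<in> row_label T ` {1..size_of T} then end_label T (row_path T (row_with_label T l))
      else let j = col_with_label T l in
        if (j, j) \<notin> ones T then end_label T (col_path T j)
        else - end_label T (row_path T (row_with_label T (- l))))"

definition zeta :: "filling \<Rightarrow> int \<Rightarrow> int" where
  "zeta T x =
     (if x \<in> {1..int (size_of T)} then zeta_pos T x
      else if - x \<in> {1..int (size_of T)} then - zeta_pos T (- x)
      else x)"


section \<open>Statistics\<close>

definition zero_EE :: "filling \<Rightarrow> nat" where
  "zero_EE T = card {b \<in> zeros T.
     (\<exists>i\<in>{1..size_of T}. (East, b) \<in> set (row_path T i)) \<and>
     (\<exists>i\<in>{1..size_of T}. (South, b) \<in> set (row_path T i))}"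

definition zero_NN :: "filling \<Rightarrow> nat" where
  "zero_NN T = card {b \<in> zeros T.
     (\<exists>j\<in>{1..width T}. (East, b) \<in> set (col_path T j)) \<and>
     (\<exists>j\<in>{1..width T}. (South, b) \<in> set (col_path T j))}"

definition one :: "filling \<Rightarrow> nat" where
  "one T = card (ones T)"

end

theory Submission
  imports Defs
begin

text \<open>That the length is the number of inversions is the standard argument for a Coxeter group:
multiplying on the right by a generator changes \<open>inv\<close> by exactly one (\<open>inv_B_sgen\<close>), and only the
identity has no generator that lowers it (\<open>increasing_positive_imp_id\<close>). Since a word and its
reversal have the same length, it also follows that \<open>\<sigma>\<close> and its inverse have equally many inversions.

For the formula in terms of the tableau, regard each zigzag path as a pipe carrying the label of
the row or column where it starts. Two pipes cross at a 0 and touch at a 1. Complete the diagram to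
a rectangle with \<open>n\<close> rows and \<open>m = n - k\<close> columns: pipes cross in the boxes above the diagonals, and
touch in the boxes outside the \<open>(k, n)\<close>-diagram. Now sweep the rectangle box by box in reading order
and write down, from southwest to northeast, the labels of the pipes that meet the border of the
swept region. A touching leaves this word unchanged. A crossing exchanges two neighbours, so that
the number of ascents of the word goes up or down by one.

The two counts of the ascents of the last word give the formula.

The first count follows the sweep. In the first word the ascents are the pairs of a row label
below a column label, and these are the boxes of the diagram together with the boxes above the
diagonals. At a 0, condition (ii) forces one of the two pipes to come straight from its row or its
column (\<open>zero_cases\<close>); therefore a crossing creates an ascent if both pipes start at rows or both
at columns, and destroys one otherwise (\<open>crossing_sign_label\<close>). Every box has contributed 1 to the first
word. With the effect of the crossings added, a 1 of the tableau contributes 1, a 0 contributes 2 or 0,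
and the boxes above the diagonals contribute in total twice the number \<open>D\<close> of those in a row with a 1 in its diagonal (\<open>frontier_ascents_statistics\<close>).

The second count reads off the last word. A pipe that does not leave the diagram at the right end
of a staircase row leaves it at the border step labeled \<open>\<sigma>(x)\<close>, where \<open>x\<close> is its own label. So the last word
begins with \<open>\<sigma>\<^sup>-\<^sup>1(n), \<dots>, \<sigma>\<^sup>-\<^sup>1(1)\<close>, and it ends with one entry for each staircase row: its
column label, up to a sign which is opposite to the one occurring among the values of
\<open>\<sigma>\<^sup>-\<^sup>1\<close>. Ascents within the first part are inversions of \<open>\<sigma>\<^sup>-\<^sup>1\<close>, and ascents from the
first to the second part are pairs of values with negative sum; the outcome is
\<open>inv(\<sigma>\<^sup>-\<^sup>1) + 2 D\<close> (\<open>frontier_ascents_inv\<close>).\<close>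

section \<open>Ascents and pairs with negative sum\<close>

definition ascents :: "int set \<Rightarrow> (int \<Rightarrow> int) \<Rightarrow> (int \<times> int) set" where
  "ascents S W = {(a, b). a \<in> S \<and> b \<in> S \<and> a < b \<and> W a < W b}"

lemma finite_ascents: "finite S \<Longrightarrow> finite (ascents S W)"
  by (rule finite_subset[of _ "S \<times> S"]) (auto simp: ascents_def)

text \<open>The transposition keeps the order of every pair of positions other than \<open>(t, t + 1)\<close>, so applying
it to both coordinates matches the remaining ascents of the two words.\<close>

lemma card_ascents_swap_descent:
  assumes S: "finite S" "t \<in> S" "t + 1 \<in> S" and W: "W (t + 1) < W t"
  shows "card (ascents S (W \<circ> transpose t (t + 1))) = Suc (card (ascents S W))"
proof -
  let ?s = "transpose t (t + 1)"
  let ?W = "W \<circ> ?s"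
  have ord: "?s a < ?s b" if "a < b" "(a, b) \<noteq> (t, t + 1)" for a b
    using that by (auto simp: transpose_def)
  have mem: "?s a \<in> S \<longleftrightarrow> a \<in> S" for a
    using S by (auto simp: transpose_def)
  have "ascents S ?W = insert (t, t + 1) (map_prod ?s ?s ` ascents S W)"
  proof (intro set_eqI iffI)
    fix p assume "p \<in> ascents S ?W"
    then obtain a b where p: "p = (a, b)" "a \<in> S" "b \<in> S" "a < b" "W (?s a) < W (?s b)"
      by (auto simp: ascents_def)
    show "p \<in> insert (t, t + 1) (map_prod ?s ?s ` ascents S W)"
    proof (cases "(a, b) = (t, t + 1)")
      case False
      with p have "(?s a, ?s b) \<in> ascents S W"
        using ord mem by (auto simp: ascents_def)
      then have "map_prod ?s ?s (?s a, ?s b) \<in> map_prod ?s ?s ` ascents S W" by blast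
      then show ?thesis using p by simp
    qed (use p in simp)
  next
    fix p assume p: "p \<in> insert (t, t + 1) (map_prod ?s ?s ` ascents S W)"
    show "p \<in> ascents S ?W"
    proof (cases "p = (t, t + 1)")
      case True
      then show ?thesis using S W by (auto simp: ascents_def)
    next
      case False
      with p obtain a b where ab: "p = (?s a, ?s b)" "a \<in> S" "b \<in> S" "a < b" "W a < W b"
        by (auto simp: ascents_def)
      moreover have "(a, b) \<noteq> (t, t + 1)" using ab W by auto
      ultimately show ?thesis using ord[of a b] mem by (auto simp: ascents_def)
    qed
  qed
  moreover have "(t, t + 1) \<notin> map_prod ?s ?s ` ascents S W"
  proof
    assume "(t, t + 1) \<in> map_prod ?s ?s ` ascents S W"
    then obtain a b where "t = ?s a" "t + 1 = ?s b" "a < b" unfolding ascents_def by blast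
    then show False by (auto simp: transpose_def split: if_splits)
  qed
  moreover have "inj (map_prod ?s ?s)" by (simp add: prod.inj_map)
  ultimately show ?thesis
    using S by (simp add: finite_ascents card_image inj_on_subset)
qed

lemma card_ascents_swap:
  assumes S: "finite S" "t \<in> S" "t + 1 \<in> S" and W: "W t \<noteq> W (t + 1)"
  shows "int (card (ascents S (W \<circ> transpose t (t + 1)))) =
    int (card (ascents S W)) + (if W (t + 1) < W t then 1 else - 1)"
proof (cases "W (t + 1) < W t")
  case True
  then show ?thesis using card_ascents_swap_descent[OF S] by simp
next
  case False
  let ?W = "W \<circ> transpose t (t + 1)"
  have "?W (t + 1) < ?W t" using False W by simp
  moreover have "?W \<circ> transpose t (t + 1) = W" by (simp add: fun_eq_iff)
  ultimately show ?thesis using card_ascents_swap_descent[OF S, of ?W] False by simp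
qed

text \<open>The ordered pairs are the pairs with \<open>i \<le> j\<close> and their mirror images, which overlap in the
diagonal. The right-hand side does not refer to the order of the positions, which makes it
convenient for rearranging them.\<close>

lemma card_pairs_split:
  fixes v :: "'a::linorder \<Rightarrow> int"
  assumes S: "finite S"
  shows "2 * card {(i, j). i \<in> S \<and> j \<in> S \<and> i \<le> j \<and> v i + v j < 0} =
    card {(i, j). i \<in> S \<and> j \<in> S \<and> v i + v j < 0} + card {i \<in> S. v i < 0}"
proof -
  let ?P = "{(i, j). i \<in> S \<and> j \<in> S \<and> i \<le> j \<and> v i + v j < 0}"
  let ?Q = "{(i, j). i \<in> S \<and> j \<in> S \<and> v i + v j < 0}"
  let ?D = "(\<lambda>i. (i, i)) ` {i \<in> S. v i < 0}"
  have fin: "finite ?P"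
    by (rule finite_subset[of _ "S \<times> S"]) (use S in auto)
  have U: "?P \<union> prod.swap ` ?P = ?Q"
    by (auto simp: image_iff add.commute)
  have I: "?P \<inter> prod.swap ` ?P = ?D"
    by (auto simp: image_iff)
  have "card ?P + card (prod.swap ` ?P) = card ?Q + card ?D"
    using card_Un_Int[of ?P "prod.swap ` ?P"] fin U I by auto
  moreover have "card (prod.swap ` ?P) = card ?P" by (intro card_image) auto
  moreover have "card ?D = card {i \<in> S. v i < 0}" by (intro card_image) (auto simp: inj_on_def)
  ultimately show ?thesis by simp
qed

text \<open>A pair with negative sum has a coordinate with a negative value, hence one in \<open>Y\<close>; so all such
pairs come from those with second coordinate in \<open>Y\<close> by mirroring.\<close>

lemma card_pairs_subset:
  fixes v :: "'a \<Rightarrow> int"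
  assumes S: "finite S" and Y: "Y \<subseteq> S" and nonneg: "\<And>x. x \<in> S - Y \<Longrightarrow> 0 \<le> v x"
  shows "card {(x, y). x \<in> S \<and> y \<in> S \<and> v x + v y < 0} + card {(x, y). x \<in> Y \<and> y \<in> Y \<and> v x + v y < 0} =
    2 * card {(x, y). x \<in> S \<and> y \<in> Y \<and> v x + v y < 0}"
proof -
  let ?SY = "{(x, y). x \<in> S \<and> y \<in> Y \<and> v x + v y < 0}"
  have fin: "finite ?SY" by (rule finite_subset[of _ "S \<times> S"]) (use S Y in auto)
  have U: "?SY \<union> prod.swap ` ?SY = {(x, y). x \<in> S \<and> y \<in> S \<and> v x + v y < 0}"
  proof (intro set_eqI)
    fix p :: "'a \<times> 'a"
    obtain x y where p: "p = (x, y)" by (cases p)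
    have "p \<in> prod.swap ` ?SY \<longleftrightarrow> (y, x) \<in> ?SY" by (auto simp: p image_iff)
    moreover have "x \<in> Y \<or> y \<in> Y" if "x \<in> S" "y \<in> S" "v x + v y < 0"
      using that nonneg[of x] nonneg[of y] by force
    ultimately show "p \<in> ?SY \<union> prod.swap ` ?SY \<longleftrightarrow> p \<in> {(x, y). x \<in> S \<and> y \<in> S \<and> v x + v y < 0}"
      using Y by (auto simp: p add.commute)
  qed
  have I: "?SY \<inter> prod.swap ` ?SY = {(x, y). x \<in> Y \<and> y \<in> Y \<and> v x + v y < 0}"
  proof (intro set_eqI)
    fix p :: "'a \<times> 'a"
    obtain x y where p: "p = (x, y)" by (cases p)
    have "p \<in> prod.swap ` ?SY \<longleftrightarrow> (y, x) \<in> ?SY" by (auto simp: p image_iff)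
    then show "p \<in> ?SY \<inter> prod.swap ` ?SY \<longleftrightarrow> p \<in> {(x, y). x \<in> Y \<and> y \<in> Y \<and> v x + v y < 0}"
      using Y by (auto simp: p add.commute)
  qed
  have "card (prod.swap ` ?SY) = card ?SY" by (intro card_image) auto
  then show ?thesis using card_Un_Int[of ?SY "prod.swap ` ?SY"] fin U I by simp
qed

section \<open>Length and inversions in type B\<close>

lemma signed_permsD:
  assumes "\<sigma> \<in> signed_perms n"
  shows "\<sigma> permutes pm_set n" "\<And>i. i \<in> pm_set n \<Longrightarrow> \<sigma> (- i) = - \<sigma> i"
    "\<And>i. i \<in> pm_set n \<Longrightarrow> \<sigma> i \<in> pm_set n"
  using assms by (auto simp: signed_perms_def permutes_in_image)

lemma signed_perms_comp:
  assumes "\<sigma> \<in> signed_perms n" "\<tau> \<in> signed_perms n"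
  shows "\<sigma> \<circ> \<tau> \<in> signed_perms n"
  using assms signed_permsD[OF assms(1)] signed_permsD[OF assms(2)]
  by (auto simp: signed_perms_def permutes_compose)

lemma id_signed_perms: "id \<in> signed_perms n"
  by (auto simp: signed_perms_def permutes_id)

lemma sgen_signed_perms:
  assumes "i < n"
  shows "sgen i \<in> signed_perms n"
proof (cases "i = 0")
  case True
  then show ?thesis using assms
    by (auto simp: signed_perms_def sgen_def pm_set_def transpose_def intro!: permutes_swap_id)
next
  case False
  then have "transpose (int i) (int i + 1) permutes pm_set n"
      "transpose (- int i) (- (int i + 1)) permutes pm_set n"
    using assms by (auto simp: pm_set_def intro!: permutes_swap_id)
  then have "sgen i permutes pm_set n" using False by (simp add: sgen_def permutes_compose)
  moreover have "sgen i (- j) = - sgen i j" for j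
    using False by (auto simp: sgen_def transpose_def)
  ultimately show ?thesis by (simp add: signed_perms_def)
qed

lemma sgen_involution: "sgen i \<circ> sgen i = id"
  by (rule ext) (auto simp: sgen_def transpose_def)

lemma sgen_pos:
  assumes "0 < i" "1 \<le> x"
  shows "sgen i x = transpose (int i) (int i + 1) x"
  using assms by (auto simp: sgen_def transpose_def)

lemma sgen_0: "x \<ge> 1 \<Longrightarrow> sgen 0 x = (if x = 1 then - 1 else x)"
  by (auto simp: sgen_def transpose_def)

lemma inv_B_signed:
  assumes \<sigma>: "\<sigma> \<in> signed_perms n"
  shows "inv_B n \<sigma> = card (ascents {1..int n} (\<lambda>i. - \<sigma> i)) +
    card {(i, j). i \<in> {1..int n} \<and> j \<in> {1..int n} \<and> i \<le> j \<and> \<sigma> i + \<sigma> j < 0}"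
proof -
  have "\<sigma> (- i) = - \<sigma> i" if "i \<in> {1..int n}" for i
    using that by (intro signed_permsD(2)[OF \<sigma>]) (auto simp: pm_set_def)
  then have "{(i, j). i \<in> {1..int n} \<and> j \<in> {1..int n} \<and> i \<le> j \<and> \<sigma> (- i) > \<sigma> j} =
      {(i, j). i \<in> {1..int n} \<and> j \<in> {1..int n} \<and> i \<le> j \<and> \<sigma> i + \<sigma> j < 0}"
    by auto
  then show ?thesis by (simp add: inv_B_def ascents_def)
qed

lemma twice_inv_B:
  assumes \<sigma>: "\<sigma> \<in> signed_perms n"
  shows "2 * inv_B n \<sigma> = 2 * card (ascents {1..int n} (\<lambda>i. - \<sigma> i)) +
    card {(i, j). i \<in> {1..int n} \<and> j \<in> {1..int n} \<and> \<sigma> i + \<sigma> j < 0} +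
    card {i \<in> {1..int n}. \<sigma> i < 0}"
  using inv_B_signed[OF \<sigma>] card_pairs_split[of "{1..int n}" \<sigma>] by simp

text \<open>Exchanging two neighbours creates one inversion in the sense of type A, and permutes the pairs
with negative sum.\<close>

lemma inv_B_swap_ascent:
  assumes \<sigma>: "\<sigma> \<in> signed_perms n" and i: "0 < i" "i < n" and asc: "\<sigma> (int i) < \<sigma> (int i + 1)"
  shows "inv_B n (\<sigma> \<circ> sgen i) = Suc (inv_B n \<sigma>)"
proof -
  let ?S = "{1..int n}"
  let ?s = "transpose (int i) (int i + 1)"
  have \<sigma>': "\<sigma> \<circ> sgen i \<in> signed_perms n"
    using \<sigma> i by (intro signed_perms_comp sgen_signed_perms)
  have s: "?s x \<in> ?S \<longleftrightarrow> x \<in> ?S" for x using i by (auto simp: transpose_def)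
  have eq: "\<sigma> (sgen i x) = \<sigma> (?s x)" if "x \<in> ?S" for x using that i by (simp add: sgen_pos)
  have "ascents ?S (\<lambda>x. - (\<sigma> \<circ> sgen i) x) = ascents ?S ((\<lambda>x. - \<sigma> x) \<circ> ?s)"
    by (auto simp: ascents_def eq)
  then have 1: "card (ascents ?S (\<lambda>x. - (\<sigma> \<circ> sgen i) x)) = Suc (card (ascents ?S (\<lambda>x. - \<sigma> x)))"
    using card_ascents_swap_descent[of ?S "int i" "\<lambda>x. - \<sigma> x"] i asc by simp
  have "bij_betw (map_prod ?s ?s) {(i, j). i \<in> ?S \<and> j \<in> ?S \<and> \<sigma> i + \<sigma> j < 0}
      {(a, b). a \<in> ?S \<and> b \<in> ?S \<and> (\<sigma> \<circ> sgen i) a + (\<sigma> \<circ> sgen i) b < 0}"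
    by (rule bij_betwI[where g = "map_prod ?s ?s"]) (use s eq in \<open>auto simp del: atLeastAtMost_iff\<close>)
  note 2 = bij_betw_same_card[OF this]
  have "bij_betw ?s {i \<in> ?S. \<sigma> i < 0} {a \<in> ?S. (\<sigma> \<circ> sgen i) a < 0}"
    by (rule bij_betwI[where g = ?s]) (use s eq in \<open>auto simp del: atLeastAtMost_iff\<close>)
  note 3 = bij_betw_same_card[OF this]
  show ?thesis using twice_inv_B[OF \<sigma>] twice_inv_B[OF \<sigma>'] 1 2 3 by simp
qed

text \<open>Isolates the contribution of the value at 1. Changing the sign of this value exchanges the two
cardinalities that contain it.\<close>

lemma inv_B_split_first:
  assumes \<sigma>: "\<sigma> \<in> signed_perms n" and n: "1 \<le> n"
  defines "R \<equiv> {2..int n}"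
  shows "inv_B n \<sigma> = card (ascents R (\<lambda>i. - \<sigma> i)) +
    card {(i, j). i \<in> R \<and> j \<in> R \<and> i \<le> j \<and> \<sigma> i + \<sigma> j < 0} +
    card {j \<in> R. \<sigma> j < \<sigma> 1} + card {j \<in> R. \<sigma> j < - \<sigma> 1} + (if \<sigma> 1 < 0 then 1 else 0)"
proof -
  let ?S = "{1..int n}"
  have S: "?S = insert 1 R" "1 \<notin> R" "finite R" using n by (auto simp: R_def)
  have R: "j > 1" if "j \<in> R" for j using that by (auto simp: R_def)
  have a: "ascents ?S (\<lambda>i. - \<sigma> i) = ascents R (\<lambda>i. - \<sigma> i) \<union> Pair 1 ` {j \<in> R. \<sigma> j < \<sigma> 1}"
    unfolding S(1) by (auto simp: ascents_def image_iff dest: R)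
  have b: "{(i, j). i \<in> ?S \<and> j \<in> ?S \<and> i \<le> j \<and> \<sigma> i + \<sigma> j < 0} =
     {(i, j). i \<in> R \<and> j \<in> R \<and> i \<le> j \<and> \<sigma> i + \<sigma> j < 0} \<union> (Pair 1 ` {j \<in> R. \<sigma> j < - \<sigma> 1} \<union>
     (if \<sigma> 1 < 0 then {(1, 1)} else {}))" (is "_ = ?B \<union> (?C \<union> ?D)")
    unfolding S(1) by (auto simp: image_iff dest: R)
  have A: "finite (ascents R (\<lambda>i. - \<sigma> i))" using S by (simp add: finite_ascents)
  have B: "finite ?B" by (rule finite_subset[of _ "R \<times> R"]) (use S in auto)
  have "card (ascents ?S (\<lambda>i. - \<sigma> i)) = card (ascents R (\<lambda>i. - \<sigma> i)) + card {j \<in> R. \<sigma> j < \<sigma> 1}"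
    unfolding a using S A
    by (subst card_Un_disjoint) (simp_all add: card_image inj_on_def, force simp: ascents_def)
  moreover have "card (?B \<union> (?C \<union> ?D)) = card ?B + (card ?C + card ?D)"
    using S B by (subst card_Un_disjoint, simp, simp, force, subst card_Un_disjoint) auto
  moreover have "card ?C = card {j \<in> R. \<sigma> j < - \<sigma> 1}"
    by (intro card_image) (auto simp: inj_on_def)
  ultimately show ?thesis using inv_B_signed[OF \<sigma>] b by simp
qed

lemma inv_B_negate_first:
  assumes \<sigma>: "\<sigma> \<in> signed_perms n" and n: "1 \<le> n" and pos: "0 < \<sigma> 1"
  shows "inv_B n (\<sigma> \<circ> sgen 0) = Suc (inv_B n \<sigma>)"
proof -
  let ?R = "{2..int n}"
  have \<sigma>': "\<sigma> \<circ> sgen 0 \<in> signed_perms n"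
    using \<sigma> n by (intro signed_perms_comp sgen_signed_perms) auto
  have e: "\<sigma> (sgen 0 x) = \<sigma> x" if "x \<in> ?R" for x using that by (simp add: sgen_0)
  \<comment> \<open>This exchanges the two counts in \<open>inv_B_split_first\<close> and adds the pair \<open>(1, 1)\<close>.\<close>
  have e1: "\<sigma> (sgen 0 1) = - \<sigma> 1"
    using signed_permsD(2)[OF \<sigma>, of 1] n by (simp add: sgen_0 pm_set_def)
  have "ascents ?R (\<lambda>i. - (\<sigma> \<circ> sgen 0) i) = ascents ?R (\<lambda>i. - \<sigma> i)"
    by (auto simp: ascents_def e)
  moreover have "{(i, j). i \<in> ?R \<and> j \<in> ?R \<and> i \<le> j \<and> (\<sigma> \<circ> sgen 0) i + (\<sigma> \<circ> sgen 0) j < 0} =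
    {(i, j). i \<in> ?R \<and> j \<in> ?R \<and> i \<le> j \<and> \<sigma> i + \<sigma> j < 0}" by (auto simp: e)
  moreover have "{j \<in> ?R. (\<sigma> \<circ> sgen 0) j < c} = {j \<in> ?R. \<sigma> j < c}" for c
    by (auto simp: e)
  ultimately show ?thesis
    using inv_B_split_first[OF \<sigma> n] inv_B_split_first[OF \<sigma>' n] pos e1 by simp
qed

text \<open>Generators are involutions, so the case of a descent of \<open>\<sigma>\<close> is the case of an ascent of
\<open>\<sigma> \<circ> s\<^sub>i\<close>.\<close>

lemma inv_B_sgen:
  assumes \<sigma>: "\<sigma> \<in> signed_perms n" and i: "i < n"
  defines "asc \<equiv> (if i = 0 then 0 < \<sigma> 1 else \<sigma> (int i) < \<sigma> (int i + 1))"
  shows "asc \<Longrightarrow> inv_B n (\<sigma> \<circ> sgen i) = Suc (inv_B n \<sigma>)"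
    and "\<not> asc \<Longrightarrow> inv_B n \<sigma> = Suc (inv_B n (\<sigma> \<circ> sgen i))"
proof -
  show "inv_B n (\<sigma> \<circ> sgen i) = Suc (inv_B n \<sigma>)" if asc
    using that inv_B_swap_ascent[OF \<sigma>] inv_B_negate_first[OF \<sigma>] i
    by (auto simp: asc_def split: if_splits)
  assume na: "\<not> asc"
  let ?\<tau> = "\<sigma> \<circ> sgen i"
  have \<tau>: "?\<tau> \<in> signed_perms n"
    using \<sigma> i by (intro signed_perms_comp sgen_signed_perms)
  have inv: "?\<tau> \<circ> sgen i = \<sigma>" using sgen_involution[of i] by (simp add: comp_assoc)
  show "inv_B n \<sigma> = Suc (inv_B n ?\<tau>)"
  proof (cases "i = 0")
    case True
    have "\<sigma> 1 \<noteq> 0" using signed_permsD(3)[OF \<sigma>, of 1] i by (auto simp: pm_set_def)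
    then have "0 < ?\<tau> 1" using na True signed_permsD(2)[OF \<sigma>, of 1] i
      by (simp add: sgen_0 pm_set_def asc_def)
    then show ?thesis using inv_B_negate_first[OF \<tau>] inv i True by simp
  next
    case False
    have "\<sigma> (int i) \<noteq> \<sigma> (int i + 1)"
      using injD[OF permutes_inj[OF signed_permsD(1)[OF \<sigma>]], of "int i" "int i + 1"] by auto
    then have "?\<tau> (int i) < ?\<tau> (int i + 1)" using na False by (simp add: sgen_pos asc_def)
    then show ?thesis using inv_B_swap_ascent[OF \<tau>, of i] inv i False by simp
  qed
qed

text \<open>The values at \<open>1, \<dots>, n\<close> would be strictly increasing integers between 1 and \<open>n\<close>.\<close>

lemma increasing_positive_imp_id:
  assumes \<sigma>: "\<sigma> \<in> signed_perms n" and pos: "1 \<le> n \<Longrightarrow> 0 < \<sigma> 1"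
    and inc: "\<And>i. 0 < i \<Longrightarrow> i < n \<Longrightarrow> \<sigma> (int i) < \<sigma> (int i + 1)"
  shows "\<sigma> = id"
proof -
  have lower: "int i \<le> \<sigma> (int i)" if "1 \<le> i" "i \<le> n" for i
    using that
  proof (induction i rule: dec_induct)
    case base
    then show ?case using pos by simp
  next
    case (step i)
    then show ?case using inc[of i] by (simp add: algebra_simps)
  qed
  have upper: "\<sigma> (int i) \<le> int i" if "i \<le> n" "1 \<le> i" for i
    using that
  proof (induction i rule: inc_induct)
    case base
    then show ?case using signed_permsD(3)[OF \<sigma>, of "int n"] by (auto simp: pm_set_def)
  next
    case (step i)
    then show ?case using inc[of i] by (simp add: algebra_simps)
  qed
  have fixp: "\<sigma> x = x" if "x \<in> {1..int n}" for x
    using that lower[of "nat x"] upper[of "nat x"] by (simp add: le_nat_iff nat_le_iff)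
  show ?thesis
  proof
    fix x
    consider "x \<in> {1..int n}" | "- x \<in> {1..int n}" | "x \<notin> pm_set n"
      by (fastforce simp: pm_set_def)
    then show "\<sigma> x = id x"
    proof cases
      case 2
      then show ?thesis using signed_permsD(2)[OF \<sigma>, of "- x"] fixp[of "- x"]
        by (auto simp: pm_set_def)
    next
      case 3
      then show ?thesis using signed_permsD(1)[OF \<sigma>] by (simp add: permutes_not_in)
    qed (use fixp in simp)
  qed
qed

definition word_perm :: "nat list \<Rightarrow> int \<Rightarrow> int" where
  "word_perm w = foldr (\<circ>) (map sgen w) id"

lemma word_perm_Nil [simp]: "word_perm [] = id"
  by (simp add: word_perm_def)

lemma word_perm_append: "word_perm (u @ w) = word_perm u \<circ> word_perm w"
  by (induction u) (simp_all add: word_perm_def comp_assoc)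

lemma word_perm_single [simp]: "word_perm [i] = sgen i"
  by (simp add: word_perm_def)

lemma word_perm_signed: "set w \<subseteq> {0..<n} \<Longrightarrow> word_perm w \<in> signed_perms n"
  by (induction w rule: rev_induct)
    (auto simp: word_perm_append id_signed_perms intro!: signed_perms_comp sgen_signed_perms)

lemma word_perm_rev: "word_perm (rev w) \<circ> word_perm w = id"
proof (induction w rule: rev_induct)
  case (snoc i w)
  have "word_perm (rev (w @ [i])) \<circ> word_perm (w @ [i]) =
      sgen i \<circ> (word_perm (rev w) \<circ> word_perm w) \<circ> sgen i"
    using word_perm_append[of "[i]" "rev w"] by (simp add: word_perm_append comp_assoc)
  then show ?case unfolding snoc by (simp only: comp_id sgen_involution)
qed simp

lemma inv_B_id: "inv_B n id = 0"
proof -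
  have "ascents {1..int n} (\<lambda>i. - id i) = {}" by (auto simp: ascents_def)
  moreover have "{(i, j). i \<in> {1..int n} \<and> j \<in> {1..int n} \<and> i \<le> j \<and> id i + id j < 0} = {}"
    by auto
  ultimately show ?thesis using inv_B_signed[OF id_signed_perms, of n] by (metis add_0 card.empty)
qed

lemma inv_B_word_le: "set w \<subseteq> {0..<n} \<Longrightarrow> inv_B n (word_perm w) \<le> length w"
proof (induction w rule: rev_induct)
  case Nil
  then show ?case by (metis inv_B_id word_perm_Nil le0)
next
  case (snoc i w)
  then have "word_perm w \<in> signed_perms n" "i < n" using word_perm_signed by auto
  from inv_B_sgen[OF this] have "inv_B n (word_perm w \<circ> sgen i) \<le> Suc (inv_B n (word_perm w))"
    by linarith
  also have "\<dots> \<le> length (w @ [i])" using snoc by simp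
  finally show ?case by (simp only: word_perm_append word_perm_single)
qed

lemma ex_reduced_word:
  assumes "\<sigma> \<in> signed_perms n"
  shows "\<exists>w. length w = inv_B n \<sigma> \<and> set w \<subseteq> {0..<n} \<and> \<sigma> = word_perm w"
  using assms
proof (induction "inv_B n \<sigma>" arbitrary: \<sigma> rule: less_induct)
  case less
  show ?case
  proof (cases "\<sigma> = id")
    case True
    then show ?thesis by (intro exI[of _ "[]"]) (simp add: inv_B_id)
  next
    case False
    then obtain i where i: "i < n" "inv_B n \<sigma> = Suc (inv_B n (\<sigma> \<circ> sgen i))"
      using increasing_positive_imp_id[OF less.prems] inv_B_sgen(2)[OF less.prems] by fastforce
    then obtain w where w: "length w = inv_B n (\<sigma> \<circ> sgen i)" "set w \<subseteq> {0..<n}"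
        "\<sigma> \<circ> sgen i = word_perm w"
      using less.hyps[of "\<sigma> \<circ> sgen i"]
        signed_perms_comp[OF less.prems sgen_signed_perms[OF i(1)]] by auto
    have "\<sigma> = \<sigma> \<circ> sgen i \<circ> sgen i" using sgen_involution[of i] by (simp add: comp_assoc)
    then have "\<sigma> = word_perm (w @ [i])" using w by (simp add: word_perm_append)
    then show ?thesis using i w by (intro exI[of _ "w @ [i]"]) auto
  qed
qed

theorem length_B_eq_inv_B:
  assumes "\<sigma> \<in> signed_perms n"
  shows "length_B n \<sigma> = inv_B n \<sigma>"
  unfolding length_B_def
proof (rule Least_equality)
  show "\<exists>w. length w = inv_B n \<sigma> \<and> set w \<subseteq> {0..<n} \<and> \<sigma> = foldr (\<circ>) (map sgen w) id"
    using ex_reduced_word[OF assms] by (simp add: word_perm_def)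
  show "inv_B n \<sigma> \<le> l"
    if "\<exists>w. length w = l \<and> set w \<subseteq> {0..<n} \<and> \<sigma> = foldr (\<circ>) (map sgen w) id" for l
    using that inv_B_word_le by (auto simp: word_perm_def)
qed

text \<open>Reversing a reduced word of \<open>\<sigma>\<close> gives a word of the same length for the inverse.\<close>

lemma signed_perm_inverse:
  assumes \<sigma>: "\<sigma> \<in> signed_perms n"
  shows "inv \<sigma> \<in> signed_perms n" "inv_B n (inv \<sigma>) = inv_B n \<sigma>"
proof -
  have *: "inv \<sigma> \<in> signed_perms n \<and> inv_B n (inv \<sigma>) \<le> inv_B n \<sigma>" if asm: "\<sigma> \<in> signed_perms n" for \<sigma>
  proof -
    obtain w where w: "length w = inv_B n \<sigma>" "set w \<subseteq> {0..<n}" "\<sigma> = word_perm w"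
      using ex_reduced_word[OF asm] by blast
    have "inv \<sigma> = word_perm (rev w)"
      using word_perm_rev[of w] word_perm_rev[of "rev w"] w(3) by (intro inv_unique_comp) auto
    then show ?thesis using w word_perm_signed[of "rev w" n] inv_B_word_le[of "rev w" n] by simp
  qed
  show 1: "inv \<sigma> \<in> signed_perms n" using *[OF \<sigma>] by simp
  have "inv (inv \<sigma>) = \<sigma>"
    using signed_permsD(1)[OF \<sigma>] by (simp add: permutes_bij inv_inv_eq)
  then show "inv_B n (inv \<sigma>) = inv_B n \<sigma>" using *[OF \<sigma>] *[OF 1] by simp
qed

section \<open>Pipes in a rectangle\<close>

text \<open>The place where the pipe that enters box \<open>(i, j)\<close> of a rectangle in the given direction has come
from: \<open>(East, r)\<close> is the left end of row \<open>r\<close> and \<open>(South, c)\<close> is the top of column \<open>c\<close>. Pipes go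
straight on in the boxes of \<open>X\<close> and turn in all the others. Following the pipe backwards rather than
forwards makes it evident that every edge of the rectangle belongs to exactly one pipe.\<close>

function src :: "(nat \<times> nat) set \<Rightarrow> dir \<Rightarrow> nat \<Rightarrow> nat \<Rightarrow> dir \<times> nat" where
  "src X East i j =
     (if j \<le> 1 then (East, i) else if (i, j - 1) \<in> X then src X East i (j - 1) else src X South i (j - 1))"
| "src X South i j =
     (if i \<le> 1 then (South, j) else if (i - 1, j) \<in> X then src X South (i - 1) j else src X East (i - 1) j)"
  by pat_completeness auto
termination by (relation "measure (\<lambda>(X, d, i, j). i + j)") auto

declare src.simps [simp del]

lemma src_start [simp]: "src X East i (Suc 0) = (East, i)" "src X South (Suc 0) j = (South, j)"
  by (simp_all add: src.simps)

lemma src_step: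
  "1 \<le> j \<Longrightarrow> src X East i (Suc j) = (if (i, j) \<in> X then src X East i j else src X South i j)"
  "1 \<le> i \<Longrightarrow> src X South (Suc i) j = (if (i, j) \<in> X then src X South i j else src X East i j)"
  by (simp_all add: src.simps(1)[of X i "Suc j"] src.simps(2)[of X "Suc i" j])

text \<open>Pipes run southeast, so a pipe cannot have started below or to the right of the edge under
consideration.\<close>

lemma src_bounds:
  "src X d i j = (East, r) \<Longrightarrow> (if d = East then r \<le> i else 1 < i \<and> r < i)"
  "src X d i j = (South, c) \<Longrightarrow> (if d = East then 1 < j \<and> c < j else c \<le> j)"
proof (induction X d i j rule: src.induct)
  case (1 X i j)
  {
    case 1
    then show ?case using "1.IH" by (subst (asm) src.simps) (fastforce split: if_splits)
  next
    case 2
    then show ?case using "1.IH" by (subst (asm) src.simps) (fastforce split: if_splits)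
  }
next
  case (2 X i j)
  {
    case 1
    then show ?case using "2.IH" by (subst (asm) src.simps) (fastforce split: if_splits)
  next
    case 2
    then show ?case using "2.IH" by (subst (asm) src.simps) (fastforce split: if_splits)
  }
qed

lemma src_East_straight:
  assumes "1 \<le> j0" "j0 \<le> j" "\<And>k. j0 \<le> k \<Longrightarrow> k < j \<Longrightarrow> (i, k) \<in> X"
  shows "src X East i j = src X East i j0"
  using assms(2,3)
proof (induction j rule: dec_induct)
  case (step k)
  then show ?case using assms(1) by (simp add: src_step)
qed simp

lemma src_South_straight:
  assumes "1 \<le> i0" "i0 \<le> i" "\<And>k. i0 \<le> k \<Longrightarrow> k < i \<Longrightarrow> (k, j) \<in> X"
  shows "src X South i j = src X South i0 j"
  using assms(2,3)
proof (induction i rule: dec_induct)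
  case (step k)
  then show ?case using assms(1) by (simp add: src_step)
qed simp

lemma zigzag_start: "(d, b) \<in> set (zigzag T d b)"
  by (subst zigzag.simps) simp

lemma zigzag_next:
  "(d, b) \<in> set (zigzag T d0 b0) \<Longrightarrow> b \<in> boxes T \<Longrightarrow>
    d' = (if b \<in> ones T then turn d else d) \<Longrightarrow> (d', step d' b) \<in> set (zigzag T d0 b0)"
proof (induction T d0 b0 rule: zigzag.induct)
  case (1 T d0 b0)
  show ?case
  proof (cases "b0 \<in> boxes T")
    case True
    let ?d = "if b0 \<in> ones T then turn d0 else d0"
    have z: "zigzag T d0 b0 = (d0, b0) # zigzag T ?d (step ?d b0)"
      using True by (subst zigzag.simps) (simp add: Let_def)
    show ?thesis
    proof (cases "(d, b) = (d0, b0)")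
      case True
      then show ?thesis using z 1(4) zigzag_start[of d' "step d' b" T] by auto
    next
      case False
      then show ?thesis using z 1 True by (auto simp: Let_def)
    qed
  next
    case False
    then have "zigzag T d0 b0 = [(d0, b0)]" by (subst zigzag.simps) simp
    then show ?thesis using False 1 by auto
  qed
qed

lemma zigzag_previous:
  "(d, b) \<in> set (zigzag T d0 b0) \<Longrightarrow> (d, b) = (d0, b0) \<or> (\<exists>b'\<in>boxes T. b = step d b')"
proof (induction T d0 b0 rule: zigzag.induct)
  case (1 T d0 b0)
  then show ?case by (subst (asm) (2) zigzag.simps) (auto simp: Let_def split: if_splits)
qed

lemma zigzag_last: "zigzag T d b \<noteq> [] \<and> snd (last (zigzag T d b)) \<notin> boxes T"
proof (induction T d b rule: zigzag.induct)
  case (1 T d b)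
  then show ?case by (subst (1 2) zigzag.simps) (auto simp: Let_def)
qed

section \<open>Tableaux inside their rectangle\<close>

locale tableau_B =
  fixes T :: filling and n :: nat
  assumes PT: "T \<in> PT_B n"
begin

abbreviation "m \<equiv> width T"

text \<open>The boxes of the rectangle that lie above the diagonals, over the staircase. Letting the pipes cross
there extends the start of column \<open>j\<close> from \<open>(j, j)\<close> to the top edge of the rectangle, and the end of
staircase row \<open>i\<close> to the right edge.\<close>

definition above :: "(nat \<times> nat) set" where
  "above = {(i, j). 1 \<le> i \<and> i < j \<and> j \<le> m}"

definition straight :: "(nat \<times> nat) set" where
  "straight = zeros T \<union> above"

abbreviation "source \<equiv> src straight"

fun label :: "dir \<times> nat \<Rightarrow> int" where
  "label (East, i) = row_label T i"
| "label (South, j) = col_label T j"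

fun path :: "dir \<times> nat \<Rightarrow> (dir \<times> nat \<times> nat) list" where
  "path (East, i) = row_path T i"
| "path (South, j) = col_path T j"

lemma n_eq: "n = length (parts T) + m"
  using PT by (simp add: PT_B_def size_of_def)

lemma parts_antimono: "r \<le> r' \<Longrightarrow> r' < length (parts T) \<Longrightarrow> parts T ! r' \<le> parts T ! r"
  using PT sorted_wrt_nth_less[of "(\<ge>)" "parts T" r r'] by (cases "r = r'") (auto simp: PT_B_def filled_diagram_def)

lemma parts_le: "r < length (parts T) \<Longrightarrow> parts T ! r \<le> m"
  using PT by (auto simp: PT_B_def filled_diagram_def)

lemma box_staircase: "i \<le> m \<Longrightarrow> (i, j) \<in> boxes T \<longleftrightarrow> 1 \<le> j \<and> j \<le> i"
  by (auto simp: boxes_def)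

lemma box_below: "m < i \<Longrightarrow> (i, j) \<in> boxes T \<longleftrightarrow> i \<le> n \<and> 1 \<le> j \<and> j \<le> parts T ! (i - m - 1)"
  by (auto simp: boxes_def n_eq intro!: exI[of _ "i - m"])

lemma box_range: "(i, j) \<in> boxes T \<Longrightarrow> 1 \<le> i \<and> i \<le> n \<and> 1 \<le> j \<and> j \<le> m \<and> j \<le> i"
proof (cases "i \<le> m")
  case False
  assume "(i, j) \<in> boxes T"
  then have b: "i \<le> n" "1 \<le> j" "j \<le> parts T ! (i - m - 1)" using False by (auto simp: box_below)
  then have "parts T ! (i - m - 1) \<le> m" using False by (intro parts_le) (simp add: n_eq)
  then show ?thesis using b False by linarith
qed (auto simp: box_staircase n_eq)

lemma box_left: "(i, j) \<in> boxes T \<Longrightarrow> 1 \<le> j' \<Longrightarrow> j' \<le> j \<Longrightarrow> (i, j') \<in> boxes T"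
  by (cases "i \<le> m") (auto simp: box_staircase box_below)

lemma box_up:
  assumes "(i, j) \<in> boxes T" "j \<le> i'" "i' \<le> i"
  shows "(i', j) \<in> boxes T"
proof (cases "i' \<le> m")
  case True
  then show ?thesis using assms box_range[OF assms(1)] by (simp add: box_staircase)
next
  case False
  then have b: "i \<le> n" "1 \<le> j" "j \<le> parts T ! (i - m - 1)" "m < i" "m < i'"
    using assms by (auto simp: box_below)
  moreover have "parts T ! (i - m - 1) \<le> parts T ! (i' - m - 1)"
    using b assms by (intro parts_antimono) (auto simp: n_eq)
  ultimately show ?thesis using assms by (auto simp: box_below)
qed

lemma ones_boxes: "ones T \<subseteq> boxes T"
  using PT by (simp add: PT_B_def filled_diagram_def)

lemma straight_box: "b \<in> boxes T \<Longrightarrow> b \<in> straight \<longleftrightarrow> b \<notin> ones T"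
  using box_range[of "fst b" "snd b"] by (cases b) (auto simp: straight_def zeros_def above_def)

lemma zeros_above_disjoint: "zeros T \<inter> above = {}"
  using box_range by (force simp: zeros_def above_def)

lemma finite_above: "finite above"
  by (rule finite_subset[of _ "{..m} \<times> {..m}"]) (auto simp: above_def)

lemma straight_above: "1 \<le> i \<Longrightarrow> i < j \<Longrightarrow> j \<le> m \<Longrightarrow> (i, j) \<in> straight"
  by (simp add: straight_def above_def)

lemma zero_diagonal_row: "1 \<le> i \<Longrightarrow> i \<le> m \<Longrightarrow> (i, i) \<notin> ones T \<Longrightarrow> (i, j) \<notin> ones T"
  using PT by (auto simp: PT_B_def)

text \<open>This is how condition (ii) enters: left of a 0 in its row, or above it in its column, there are
only 0s.\<close>

lemma zero_cases:
  assumes "(i, j) \<in> zeros T"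
  shows "source East i j = (East, i) \<or> source South i j = (South, j)"
proof -
  have b: "(i, j) \<in> boxes T" "(i, j) \<notin> ones T" using assms by (auto simp: zeros_def)
  note r = box_range[OF b(1)]
  have "(\<forall>k<j. (i, k) \<notin> ones T) \<or> (\<forall>k<i. (k, j) \<notin> ones T)"
    using PT b by (fastforce simp: PT_B_def)
  then show ?thesis
  proof
    assume *: "\<forall>k<j. (i, k) \<notin> ones T"
    have "source East i j = source East i 1"
      using r * box_left[OF b(1)] by (intro src_East_straight) (auto simp: straight_box)
    then show ?thesis by simp
  next
    assume *: "\<forall>k<i. (k, j) \<notin> ones T"
    have "(k, j) \<in> straight" if "1 \<le> k" "k < i" for k
    proof (cases "k < j")
      case True
      then show ?thesis using that r by (intro straight_above) auto
    next
      case False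
      then show ?thesis using box_up[OF b(1), of k] that * by (simp add: straight_box)
    qed
    then have "source South i j = source South 1 j"
      using r by (intro src_South_straight) auto
    then show ?thesis by simp
  qed
qed

section \<open>Labels of rows and columns\<close>

definition height :: "nat \<Rightarrow> nat" where
  "height j = card {r. 1 \<le> r \<and> (m + r, j) \<in> boxes T}"

lemma col_label_eq:
  assumes "1 \<le> j"
  shows "col_label T j = 1 + int m - int j + int (height j)"
proof -
  have "{r \<in> {1..length (parts T)}. j \<le> parts T ! (r - 1)} = {r. 1 \<le> r \<and> (m + r, j) \<in> boxes T}"
    using assms by (auto simp: box_below n_eq)
  then show ?thesis by (simp add: col_label_def height_def)
qed

lemma row_label_staircase: "i \<le> m \<Longrightarrow> row_label T i = - col_label T i"
  by (simp add: row_label_def)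

lemma row_label_below: "m < i \<Longrightarrow> i \<le> n \<Longrightarrow> row_label T i = int i - int (parts T ! (i - m - 1))"
  by (auto simp: row_label_def Let_def of_nat_diff)

lemma finite_column: "finite {r. 1 \<le> r \<and> (m + r, j) \<in> boxes T}"
  by (rule finite_subset[of _ "{..n}"]) (use box_range in force)+

lemma height_le: "m + height j \<le> n"
proof -
  have "height j \<le> card {1..length (parts T)}"
    unfolding height_def by (intro card_mono) (auto dest: box_range simp: n_eq)
  then show ?thesis by (simp add: n_eq)
qed

lemma height_ge: "(m + r, j) \<in> boxes T \<Longrightarrow> r \<le> height j"
proof -
  assume b: "(m + r, j) \<in> boxes T"
  have "card {1..r} \<le> height j" unfolding height_def
  proof (rule card_mono[OF finite_column], rule subsetI)
    fix q assume "q \<in> {1..r}"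
    then show "q \<in> {r. 1 \<le> r \<and> (m + r, j) \<in> boxes T}" using box_up[OF b, of "m + q"] box_range[OF b] by auto
  qed
  then show ?thesis by simp
qed

lemma height_less: "1 \<le> r \<Longrightarrow> j \<le> m \<Longrightarrow> (m + r, j) \<notin> boxes T \<Longrightarrow> height j < r"
proof -
  assume b: "(m + r, j) \<notin> boxes T" and r: "1 \<le> r" "j \<le> m"
  have "height j \<le> card {1..<r}" unfolding height_def
  proof (rule card_mono, simp, rule subsetI)
    fix q assume q: "q \<in> {r. 1 \<le> r \<and> (m + r, j) \<in> boxes T}"
    then have "\<not> r \<le> q" using box_up[of "m + q" j "m + r"] b r by auto
    then show "q \<in> {1..<r}" using q by auto
  qed
  then show ?thesis using r by simp
qed

lemma col_label_range: "1 \<le> j \<Longrightarrow> j \<le> m \<Longrightarrow> 1 \<le> col_label T j \<and> col_label T j \<le> int n"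
  using height_le[of j] by (simp add: col_label_eq)

lemma col_label_strict: "1 \<le> j \<Longrightarrow> j < j' \<Longrightarrow> j' \<le> m \<Longrightarrow> col_label T j' < col_label T j"
proof -
  assume j: "1 \<le> j" "j < j'" "j' \<le> m"
  have "height j' \<le> height j" unfolding height_def
    using j by (intro card_mono finite_column) (auto intro: box_left)
  then show ?thesis using j by (simp add: col_label_eq)
qed

lemma row_label_range: "m < i \<Longrightarrow> i \<le> n \<Longrightarrow> 1 \<le> row_label T i \<and> row_label T i \<le> int n"
proof -
  assume i: "m < i" "i \<le> n"
  then have "parts T ! (i - m - 1) \<le> m" by (intro parts_le) (simp add: n_eq)
  then show ?thesis using i by (simp add: row_label_below)
qed

lemma row_label_strict: "1 \<le> i \<Longrightarrow> i < i' \<Longrightarrow> i' \<le> n \<Longrightarrow> row_label T i < row_label T i'"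
proof -
  assume i: "1 \<le> i" "i < i'" "i' \<le> n"
  consider "i' \<le> m" | "i \<le> m" "m < i'" | "m < i" by linarith
  then show ?thesis
  proof cases
    case 1
    then show ?thesis using i col_label_strict[of i i'] by (simp add: row_label_staircase)
  next
    case 2
    then show ?thesis using i col_label_range[of i] row_label_range[of i']
      by (simp add: row_label_staircase)
  next
    case 3
    have "parts T ! (i' - m - 1) \<le> parts T ! (i - m - 1)"
      using i 3 by (intro parts_antimono) (auto simp: n_eq)
    then show ?thesis using i 3 by (simp add: row_label_below)
  qed
qed

lemma row_label_inj: "i \<in> {1..n} \<Longrightarrow> i' \<in> {1..n} \<Longrightarrow> row_label T i = row_label T i' \<Longrightarrow> i = i'"
  using row_label_strict[of i i'] row_label_strict[of i' i] by (cases i i' rule: linorder_cases) auto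

lemma col_label_inj: "i \<in> {1..m} \<Longrightarrow> i' \<in> {1..m} \<Longrightarrow> col_label T i = col_label T i' \<Longrightarrow> i = i'"
  using col_label_strict[of i i'] col_label_strict[of i' i] by (cases i i' rule: linorder_cases) auto

text \<open>Row \<open>i\<close> meets column \<open>j\<close> in the \<open>(k, n)\<close>-diagram iff the border passes the vertical step of the row
before the horizontal step of the column.\<close>

lemma row_col_label:
  assumes "1 \<le> i" "i \<le> n" "1 \<le> j" "j \<le> m"
  shows "(i, j) \<in> boxes T \<union> above \<Longrightarrow> row_label T i < col_label T j"
    and "(i, j) \<notin> boxes T \<union> above \<Longrightarrow> col_label T j < row_label T i"
proof -
  show "row_label T i < col_label T j" if "(i, j) \<in> boxes T \<union> above"
  proof (cases "i \<le> m")
    case True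
    then show ?thesis using assms col_label_range[of i] col_label_range[of j]
      by (simp add: row_label_staircase)
  next
    case False
    then have "(i, j) \<in> boxes T" using that by (auto simp: above_def)
    then show ?thesis using False assms height_ge[of "i - m" j]
      by (simp add: row_label_below col_label_eq box_below)
  qed
  show "col_label T j < row_label T i" if "(i, j) \<notin> boxes T \<union> above"
  proof -
    have i: "m < i" using that assms box_staircase[of i j] by (fastforce simp: above_def)
    then have "height j < i - m" using that assms by (intro height_less) auto
    moreover have "parts T ! (i - m - 1) < j" using that assms i by (auto simp: box_below)
    ultimately show ?thesis using assms i by (simp add: row_label_below col_label_eq)
  qed
qed

lemma labels_onto: "{1..int n} = row_label T ` {m<..n} \<union> col_label T ` {1..m}"
proof (rule sym, rule card_subset_eq)
  show "row_label T ` {m<..n} \<union> col_label T ` {1..m} \<subseteq> {1..int n}"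
    using row_label_range col_label_range by auto
  have "row_label T i \<noteq> col_label T j" if "i \<in> {m<..n}" "j \<in> {1..m}" for i j
    using row_col_label[of i j] that by fastforce
  then have "card (row_label T ` {m<..n} \<union> col_label T ` {1..m}) =
      card (row_label T ` {m<..n}) + card (col_label T ` {1..m})"
    by (intro card_Un_disjoint) auto
  also have "card (row_label T ` {m<..n}) = n - m"
    by (subst card_image) (auto intro!: inj_onI row_label_inj)
  also have "card (col_label T ` {1..m}) = m"
    by (subst card_image) (auto intro!: inj_onI col_label_inj)
  finally show "card (row_label T ` {m<..n} \<union> col_label T ` {1..m}) = card {1..int n}"
    by (simp add: n_eq)
qed simp

lemma row_with_label: "i \<in> {1..n} \<Longrightarrow> row_with_label T (row_label T i) = i"
  using PT unfolding row_with_label_def PT_B_def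
  by (intro the_equality) (auto intro: row_label_inj)

lemma col_with_label: "j \<in> {1..m} \<Longrightarrow> col_with_label T (col_label T j) = j"
  unfolding col_with_label_def by (intro the_equality) (auto intro: col_label_inj)

section \<open>Which pipes cross at a box\<close>

definition crossing_sign :: "nat \<times> nat \<Rightarrow> int" where
  "crossing_sign = (\<lambda>(i, j). if fst (source East i j) = fst (source South i j) then 1 else - 1)"

text \<open>The pipe that leaves a staircase row at its right end is always a trivial one. If the diagonal
contains 1, this is the pipe of its column, which turns there at once. If it contains 0, then by (iii)
the row contains only 0s and its own pipe runs straight through.\<close>

lemma trivial_source:
  assumes "1 \<le> i" "i \<le> m" "i < j" "j \<le> m + 1"
  shows "source East i j = (if (i, i) \<in> ones T then (South, i) else (East, i))"
proof -
  have b: "(i, i) \<in> boxes T" using assms by (simp add: box_staircase)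
  have "source East i j = source East i (Suc i)"
    using assms by (intro src_East_straight) (auto intro: straight_above)
  then have 1: "source East i j = (if (i, i) \<in> ones T then source South i i else source East i i)"
    using src_step(1)[of i straight i] straight_box[OF b] assms by simp
  have "source South i i = source South 1 i"
    using assms by (intro src_South_straight) (auto intro: straight_above)
  then have 2: "source South i i = (South, i)" by simp
  have "source East i i = source East i 1" if "(i, i) \<notin> ones T"
    using that assms zero_diagonal_row[of i]
    by (intro src_East_straight) (auto simp: box_staircase straight_box)
  then show ?thesis using 1 2 by simp
qed

lemma South_above: "1 \<le> i \<Longrightarrow> i \<le> j \<Longrightarrow> j \<le> m \<Longrightarrow> source South i j = (South, j)"
  using src_South_straight[of 1 i j straight] straight_above by auto

lemma source_valid:
  assumes "1 \<le> i" "i \<le> n + 1" "1 \<le> j" "j \<le> m + 1" "d = East \<Longrightarrow> i \<le> n" "d = South \<Longrightarrow> j \<le> m"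
  shows "source d i j \<in> {East} \<times> {1..n} \<union> {South} \<times> {1..m}"
  using assms
proof (induction "i + j" arbitrary: d i j rule: less_induct)
  case less
  let ?V = "{East} \<times> {1..n} \<union> {South} \<times> {1..m}"
  show ?case
  proof (cases d)
    case East
    show ?thesis
    proof (cases "j = 1")
      case True
      then show ?thesis using East less.prems by simp
    next
      case False
      then obtain k where k: "j = Suc k" "1 \<le> k" using less.prems by (cases j) auto
      have "source East i k \<in> ?V" using k East less.prems by (intro less.hyps) auto
      moreover have "source South i k \<in> ?V" using k East less.prems by (intro less.hyps) auto
      ultimately show ?thesis using k East by (simp only: src_step split: if_split) blast
    qed
  next
    case South
    show ?thesis
    proof (cases "i = 1")
      case True
      then show ?thesis using South less.prems by simp
    next
      case False
      then obtain k where k: "i = Suc k" "1 \<le> k" using less.prems by (cases i) auto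
      have "source East k j \<in> ?V" using k South less.prems by (intro less.hyps) auto
      moreover have "source South k j \<in> ?V" using k South less.prems by (intro less.hyps) auto
      ultimately show ?thesis using k South by (simp only: src_step split: if_split) blast
    qed
  qed
qed

lemma straight_range: "(i, j) \<in> straight \<Longrightarrow> 1 \<le> i \<and> i \<le> n \<and> 1 \<le> j \<and> j \<le> m"
  using box_range by (auto simp: straight_def zeros_def above_def n_eq)

text \<open>Inside the diagram, one of the two pipes is straight by \<open>zero_cases\<close>. If the other one is of the same
kind, it started strictly above or strictly to the left of the straight one, which settles the order of
the labels. If not, the label of the row pipe is at most that of row \<open>i\<close>, the label of the column pipe
is at least that of column \<open>j\<close>, and row \<open>i\<close> meets column \<open>j\<close>. Above the diagonals the horizontal pipe is
the one of \<open>trivial_source\<close>.\<close>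

lemma crossing_sign_label:
  assumes "(i, j) \<in> straight"
  shows "label (source East i j) \<noteq> label (source South i j)"
    and "crossing_sign (i, j) = (if label (source South i j) < label (source East i j) then 1 else - 1)"
proof -
  note r = straight_range[OF assms]
  have v: "source East i j \<in> {East} \<times> {1..n} \<union> {South} \<times> {1..m}"
    "source South i j \<in> {East} \<times> {1..n} \<union> {South} \<times> {1..m}"
    using r by (intro source_valid; simp)+
  have "if fst (source East i j) = fst (source South i j)
    then label (source South i j) < label (source East i j)
    else label (source East i j) < label (source South i j)"
  proof (cases "(i, j) \<in> above")
    case True
    then have "source South i j = (South, j)"
      "source East i j = (if (i, i) \<in> ones T then (South, i) else (East, i))"
      using True trivial_source[of i j] South_above[of i j] by (auto simp: above_def)
    then show ?thesis using True r col_label_strict[of i j] row_col_label(1)[of i j]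
      by (auto simp: above_def)
  next
    case False
    then have z: "(i, j) \<in> zeros T" using assms by (simp add: straight_def)
    then have b: "(i, j) \<in> boxes T" by (simp add: zeros_def)
    from zero_cases[OF z] show ?thesis
    proof
      assume e: "source East i j = (East, i)"
      show ?thesis
      proof (cases "source South i j")
        case (Pair d c)
        show ?thesis
        proof (cases d)
          case East
          then show ?thesis using e Pair v r src_bounds(1)[of straight South i j c] row_label_strict[of c i]
            by auto
        next
          case South
          then have "1 \<le> c" "c \<le> j" using Pair v src_bounds(2)[of straight South i j c] by auto
          moreover have "row_label T i < col_label T c"
            using b r calculation box_left[of i j c] by (intro row_col_label(1)) auto
          ultimately show ?thesis using e Pair South by auto
        qed
      qed
    next
      assume s: "source South i j = (South, j)"
      show ?thesis
      proof (cases "source East i j")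
        case (Pair d c)
        show ?thesis
        proof (cases d)
          case South
          then show ?thesis using s Pair v r src_bounds(2)[of straight East i j c] col_label_strict[of c j]
            by auto
        next
          case East
          then have c: "1 \<le> c" "c \<le> i" using Pair v src_bounds(1)[of straight East i j c] by auto
          have "row_label T c \<le> row_label T i"
            using c r row_label_strict[of c i] by (cases "c = i") auto
          also have "row_label T i < col_label T j" using b r by (intro row_col_label(1)) auto
          finally show ?thesis using s Pair East by auto
        qed
      qed
    qed
  qed
  then show "label (source East i j) \<noteq> label (source South i j)"
    "crossing_sign (i, j) = (if label (source South i j) < label (source East i j) then 1 else - 1)"
    by (auto simp: crossing_sign_def split: if_splits)
qed

section \<open>The frontier read along the frontier\<close>

text \<open>The word after the boxes of the rows above \<open>i\<close> and the first \<open>j\<close> boxes of row \<open>i\<close> have been swept.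
Position \<open>x\<close> runs from 1 in the southwest to \<open>n + m\<close> in the northeast. In this order the frontier
consists of the left ends of the rows below \<open>i\<close>, the bottoms of the boxes already swept in row \<open>i\<close>, the
left side of the box to be swept next, the tops of the remaining boxes of row \<open>i\<close>, and the right ends
of the rows above \<open>i\<close>.\<close>

definition frontier :: "nat \<Rightarrow> nat \<Rightarrow> int \<Rightarrow> int" where
  "frontier i j x = (let a = x - (int n - int i) in label (
     if a \<le> 0 then (East, nat (int n + 1 - x))
     else if a \<le> int j then source South (i + 1) (nat a)
     else if a = int j + 1 then source East i (j + 1)
     else if a \<le> int m + 1 then source South i (nat (a - 1))
     else source East (nat (int n + int m + 1 - x)) (m + 1)))"

abbreviation "positions \<equiv> {1..int n + int m}"

text \<open>The two edges at which pipes enter the box occupy the positions \<open>t\<close> and \<open>t + 1\<close>, and so do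
the two edges at which they leave it; going straight therefore exchanges the positions of the two
pipes and turning keeps them.\<close>

lemma frontier_step:
  assumes i: "1 \<le> i" "i \<le> n" and j: "j < m"
  defines "t \<equiv> int n - int i + int j + 1"
  shows "(i, j + 1) \<in> straight \<Longrightarrow> frontier i (j + 1) = frontier i j \<circ> transpose t (t + 1)"
    and "(i, j + 1) \<notin> straight \<Longrightarrow> frontier i (j + 1) = frontier i j"
    and "frontier i j t = label (source East i (j + 1))"
    and "frontier i j (t + 1) = label (source South i (j + 1))"
proof -
  have new: "frontier i (j + 1) t = label (source South (i + 1) (j + 1))"
    "frontier i (j + 1) (t + 1) = label (source East i (j + 2))"
    using i j by (auto simp: frontier_def t_def nat_add_distrib)
  show old: "frontier i j t = label (source East i (j + 1))"
    "frontier i j (t + 1) = label (source South i (j + 1))"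
    using i j by (auto simp: frontier_def t_def nat_add_distrib)
  have same: "frontier i (j + 1) x = frontier i j x" if "x \<noteq> t" "x \<noteq> t + 1" for x
    using that i j by (auto simp: frontier_def t_def Let_def)
  show "frontier i (j + 1) = frontier i j \<circ> transpose t (t + 1)" if "(i, j + 1) \<in> straight"
  proof
    fix x
    show "frontier i (j + 1) x = (frontier i j \<circ> transpose t (t + 1)) x"
      using that new old same[of x] i src_step[of "j + 1" straight i] src_step(2)[of i straight "j + 1"]
      by (auto simp: transpose_def)
  qed
  show "frontier i (j + 1) = frontier i j" if "(i, j + 1) \<notin> straight"
  proof
    fix x
    show "frontier i (j + 1) x = frontier i j x"
      using that new old same[of x] i src_step[of "j + 1" straight i] src_step(2)[of i straight "j + 1"]
      by (cases "x = t"; cases "x = t + 1") auto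
  qed
qed

lemma frontier_next_row:
  assumes i: "1 \<le> i" "i < n"
  shows "frontier (i + 1) 0 = frontier i m"
proof
  fix x
  let ?a = "x - (int n - int i)"
  consider "?a \<le> - 1" | "?a = 0" | "1 \<le> ?a" "?a \<le> int m" | "?a = int m + 1" | "int m + 1 < ?a"
    by linarith
  then show "frontier (i + 1) 0 x = frontier i m x"
  proof cases
    case 2
    then have "nat (int n + 1 - x) = i + 1" by simp
    then show ?thesis using 2 by (simp add: frontier_def)
  next
    case 4
    then have "nat (int n + int m + 1 - x) = i" by simp
    then show ?thesis using 4 by (simp add: frontier_def)
  qed (simp_all add: frontier_def Let_def algebra_simps)
qed

definition frontier_ascents :: "nat \<Rightarrow> nat \<Rightarrow> int" where
  "frontier_ascents i j = int (card (ascents positions (frontier i j)))"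

lemma frontier_ascents_step:
  assumes i: "1 \<le> i" "i \<le> n" and j: "j < m"
  shows "frontier_ascents i (j + 1) = frontier_ascents i j + (if (i, j + 1) \<in> straight then crossing_sign (i, j + 1) else 0)"
proof (cases "(i, j + 1) \<in> straight")
  case True
  let ?t = "int n - int i + int j + 1"
  note w = frontier_step[OF assms]
  have "frontier_ascents i (j + 1) = int (card (ascents positions (frontier i j \<circ> transpose ?t (?t + 1))))"
    using w(1)[OF True] by (simp add: frontier_ascents_def)
  also have "\<dots> = frontier_ascents i j + (if frontier i j (?t + 1) < frontier i j ?t then 1 else - 1)"
    unfolding frontier_ascents_def using i j crossing_sign_label(1)[OF True] w(3,4)
    by (intro card_ascents_swap) auto
  finally show ?thesis using crossing_sign_label(2)[OF True] w(3,4) True by simp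
next
  case False
  then show ?thesis using frontier_step(2)[OF assms] by (simp add: frontier_ascents_def)
qed

lemma frontier_ascents_row:
  assumes i: "1 \<le> i" "i \<le> n"
  shows "j \<le> m \<Longrightarrow> frontier_ascents i j = frontier_ascents i 0 + (\<Sum>k = 1..j. if (i, k) \<in> straight then crossing_sign (i, k) else 0)"
proof (induction j)
  case (Suc j)
  then show ?case using frontier_ascents_step[OF i, of j] by simp
qed simp

lemma frontier_ascents_total:
  assumes "1 \<le> n"
  shows "frontier_ascents n m = frontier_ascents 1 0 + (\<Sum>b\<in>straight. crossing_sign b)"
proof -
  let ?f = "\<lambda>b. if b \<in> straight then crossing_sign b else 0"
  have "frontier_ascents i m = frontier_ascents 1 0 + (\<Sum>k = 1..i. \<Sum>l = 1..m. ?f (k, l))" if "1 \<le> i" "i \<le> n" for i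
    using that
  proof (induction i rule: dec_induct)
    case base
    then show ?case using assms frontier_ascents_row[of 1 m] by (subst atLeastAtMost_singleton) simp
  next
    case (step i)
    have "frontier_ascents (Suc i) m = frontier_ascents (Suc i) 0 + (\<Sum>l = 1..m. ?f (Suc i, l))"
      using step frontier_ascents_row[of "Suc i" m] by simp
    also have "frontier_ascents (Suc i) 0 = frontier_ascents i m"
      using step frontier_next_row[of i] by (simp add: frontier_ascents_def)
    finally show ?case using step by simp
  qed
  from this[of n] have "frontier_ascents n m = frontier_ascents 1 0 + (\<Sum>b\<in>{1..n} \<times> {1..m}. ?f b)"
    using assms by (simp add: sum.cartesian_product)
  also have "(\<Sum>b\<in>{1..n} \<times> {1..m}. ?f b) = (\<Sum>b\<in>straight. crossing_sign b)"
    by (rule sum.mono_neutral_cong_right) (use straight_range in \<open>force+\<close>)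
  finally show ?thesis .
qed

text \<open>Row labels decrease along the first \<open>n\<close> positions and column labels along the last \<open>m\<close>, so every
ascent pairs a row with a column.\<close>

lemma frontier_ascents_start:
  assumes "1 \<le> n"
  shows "frontier_ascents 1 0 = int (card (boxes T \<union> above))"
proof -
  have w1: "frontier 1 0 x = row_label T (nat (int n + 1 - x))" if "x \<in> {1..int n}" for x
    using that by (cases "x = int n") (auto simp: frontier_def Let_def)
  have w2: "frontier 1 0 x = col_label T (nat (x - int n))" if "x \<in> {int n<..int n + int m}" for x
    using that by (auto simp: frontier_def Let_def)
  let ?f = "\<lambda>(i, j). (int n + 1 - int i, int n + int j)"
  have "ascents positions (frontier 1 0) = ?f ` (boxes T \<union> above)"
  proof (intro set_eqI iffI)
    fix p assume "p \<in> ascents positions (frontier 1 0)"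
    then obtain a b where p: "p = (a, b)" "a \<in> positions" "b \<in> positions" "a < b" "frontier 1 0 a < frontier 1 0 b"
      by (auto simp: ascents_def)
    \<comment> \<open>Within either part the word decreases.\<close>
    have ab: "a \<le> int n" "int n < b"
    proof -
      show "int n < b"
      proof (rule ccontr)
        assume "\<not> int n < b"
        moreover from this have "row_label T (nat (int n + 1 - b)) < row_label T (nat (int n + 1 - a))"
          using p by (intro row_label_strict) (auto simp: le_nat_iff nat_le_iff)
        ultimately show False using p w1[of a] w1[of b] by auto
      qed
      show "a \<le> int n"
      proof (rule ccontr)
        assume "\<not> a \<le> int n"
        moreover from this have "col_label T (nat (b - int n)) < col_label T (nat (a - int n))"
          using p by (intro col_label_strict) (auto simp: le_nat_iff nat_le_iff)
        ultimately show False using p w2[of a] w2[of b] by auto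
      qed
    qed
    let ?i = "nat (int n + 1 - a)" and ?j = "nat (b - int n)"
    have "row_label T ?i < col_label T ?j" using p ab w1[of a] w2[of b] by auto
    then have "(?i, ?j) \<in> boxes T \<union> above"
      using row_col_label(2)[of ?i ?j] p ab by force
    moreover have "p = ?f (?i, ?j)" using p ab by simp
    ultimately show "p \<in> ?f ` (boxes T \<union> above)" by blast
  next
    fix p assume "p \<in> ?f ` (boxes T \<union> above)"
    then obtain i j where p: "p = ?f (i, j)" and b: "(i, j) \<in> boxes T \<union> above" by auto
    have r: "1 \<le> i" "i \<le> n" "1 \<le> j" "j \<le> m" using b box_range by (auto simp: above_def n_eq)
    show "p \<in> ascents positions (frontier 1 0)"
      using p r row_col_label(1)[OF r b] w1[of "int n + 1 - int i"] w2[of "int n + int j"]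
      by (auto simp: ascents_def)
  qed
  moreover have "inj ?f" by (auto simp: inj_def)
  ultimately show ?thesis by (simp add: frontier_ascents_def card_image inj_on_subset)
qed

section \<open>The last frontier and \<open>\<zeta>\<close>\<close>

text \<open>The position of the edge at which box \<open>(i, j)\<close> is entered, in every frontier that contains
this edge.\<close>

fun place :: "dir \<Rightarrow> nat \<Rightarrow> nat \<Rightarrow> int" where
  "place East i j = int n + int j - int i"
| "place South i j = int n + 1 + int j - int i"

text \<open>Outside the \<open>(k, n)\<close>-diagram pipes only turn, which does not change their position. Hence the
position at which a pipe leaves the diagram is its position in the last frontier.\<close>

lemma final_frontier_outside:
  assumes "m < i" "i \<le> n + 1" "1 \<le> j" "j \<le> m + 1" "(i, j) \<notin> boxes T"
    "d = East \<Longrightarrow> i \<le> n" "d = South \<Longrightarrow> j \<le> m"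
  shows "frontier n m (place d i j) = label (source d i j)"
  using assms
proof (induction "(n + 1 - i) + (m + 1 - j)" arbitrary: d i j rule: less_induct)
  case less
  have ns: "(i, j) \<notin> straight" if "j \<le> m"
    using less.prems by (auto simp: straight_def zeros_def above_def)
  show ?case
  proof (cases d)
    case East
    show ?thesis
    proof (cases "j \<le> m")
      case True
      have "(Suc i, j) \<notin> boxes T" using less.prems box_up[of "Suc i" j i] True by auto
      then have "frontier n m (place South (Suc i) j) = label (source South (Suc i) j)"
        using less.prems True East by (intro less.hyps) auto
      then show ?thesis using East True ns less.prems src_step(2)[of i straight j]
        by (simp add: algebra_simps)
    next
      case False
      then have j: "j = m + 1" using less.prems by simp
      have x: "nat (int n + int m + 1 - place East i j) = i" "place East i j \<ge> int m + 1"
        using j East less.prems by auto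
      then show ?thesis using j East less.prems
        by (cases "i = n") (auto simp: frontier_def Let_def)
    qed
  next
    case South
    show ?thesis
    proof (cases "i = n + 1")
      case True
      then show ?thesis using South less.prems by (simp add: frontier_def Let_def)
    next
      case False
      have "(i, Suc j) \<notin> boxes T" using less.prems box_left[of i "Suc j" j] by auto
      then have "frontier n m (place East i (Suc j)) = label (source East i (Suc j))"
        using less.prems False South by (intro less.hyps) auto
      then show ?thesis using South ns less.prems src_step(1)[of j straight i] by (simp add: algebra_simps)
    qed
  qed
qed

text \<open>The starts of the \<open>n\<close> pipes that determine \<open>\<zeta>\<close>: for each \<open>i\<close> in \<open>[n]\<close>, exactly one of \<open>i\<close> and \<open>- i\<close>
is the label of one of them. The other \<open>m\<close> pipes are those of \<open>trivial_source\<close>.\<close>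

definition active :: "dir \<times> nat \<Rightarrow> bool" where
  "active s \<longleftrightarrow> (case s of
     (East, i) \<Rightarrow> i \<in> {1..n} \<and> (i \<le> m \<longrightarrow> (i, i) \<in> ones T)
   | (South, j) \<Rightarrow> j \<in> {1..m} \<and> (j, j) \<notin> ones T)"

lemma source_along_zigzag:
  assumes "(d, b) \<in> set (zigzag T d0 b0)"
  shows "source d (fst b) (snd b) = source d0 (fst b0) (snd b0)"
  using assms
proof (induction T \<equiv> T d0 b0 rule: zigzag.induct)
  case (1 d0 b0)
  show ?case
  proof (cases "b0 \<in> boxes T")
    case True
    let ?d = "if b0 \<in> ones T then turn d0 else d0"
    obtain i j where b0: "b0 = (i, j)" by (cases b0)
    have r: "1 \<le> i" "1 \<le> j" using True b0 box_range by auto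
    have "source ?d (fst (step ?d b0)) (snd (step ?d b0)) = source d0 i j"
      using r True b0 straight_box[OF True] by (cases d0) (auto simp: src_step)
    moreover have "(d, b) = (d0, b0) \<or> (d, b) \<in> set (zigzag T ?d (step ?d b0))"
      using "1.prems" True by (subst (asm) zigzag.simps) (auto simp: Let_def)
    ultimately show ?thesis using "1.hyps"[OF True refl] b0 by auto
  next
    case False
    then show ?thesis using "1.prems" by (subst (asm) zigzag.simps) auto
  qed
qed

lemma source_along_path:
  assumes "(d, i, j) \<in> set (path s)" and "s \<in> {East} \<times> {1..n} \<union> {South} \<times> {1..m}"
  shows "source d i j = s"
proof -
  obtain d0 k where s: "s = (d0, k)" by (cases s)
  show ?thesis
  proof (cases d0)
    case East
    then show ?thesis using s assms source_along_zigzag[of d "(i, j)" East "(k, 1)"]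
      by (simp add: row_path_def)
  next
    case South
    then show ?thesis using s assms source_along_zigzag[of d "(i, j)" South "(k, k)"] South_above[of k k]
      by (simp add: col_path_def)
  qed
qed

lemma path_of_source:
  assumes "(i, j) \<in> boxes T"
  shows "(d, i, j) \<in> set (path (source d i j))"
  using assms
proof (induction "i + j" arbitrary: d i j rule: less_induct)
  case less
  note b = less.prems and r = box_range[OF less.prems]
  show ?case
  proof (cases d)
    case East
    show ?thesis
    proof (cases "j = 1")
      case True
      then show ?thesis using East by (simp add: row_path_def zigzag_start)
    next
      case False
      then obtain k where k: "j = Suc k" "1 \<le> k" using r by (cases j) auto
      have bk: "(i, k) \<in> boxes T" using box_left[OF b] k by auto
      define d' where "d' = (if (i, k) \<in> ones T then South else East)"
      have "source d i j = source d' i k"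
        using k East bk by (simp add: d'_def src_step straight_box)
      moreover have "(d', i, k) \<in> set (path (source d' i k))"
        using k bk by (intro less.hyps) auto
      moreover have "(East, step East (i, k)) \<in> set (path s)" if "(d', i, k) \<in> set (path s)" for s
      proof -
        have "East = (if (i, k) \<in> ones T then turn d' else d')" by (simp add: d'_def)
        with that bk show ?thesis
          by (cases s rule: path.cases) (auto simp: row_path_def col_path_def simp del: step.simps intro!: zigzag_next)
      qed
      ultimately show ?thesis using k East by simp
    qed
  next
    case South
    show ?thesis
    proof (cases "i = j")
      case True
      then show ?thesis using South South_above[of i i] r by (simp add: col_path_def zigzag_start)
    next
      case False
      then obtain k where k: "i = Suc k" "1 \<le> k" "j \<le> k" using r by (cases i) auto
      have bk: "(k, j) \<in> boxes T" using box_up[OF b] k by auto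
      define d' where "d' = (if (k, j) \<in> ones T then East else South)"
      have "source d i j = source d' k j"
        using k South bk by (simp add: d'_def src_step straight_box)
      moreover have "(d', k, j) \<in> set (path (source d' k j))"
        using k bk by (intro less.hyps) auto
      moreover have "(South, step South (k, j)) \<in> set (path s)" if "(d', k, j) \<in> set (path s)" for s
      proof -
        have "South = (if (k, j) \<in> ones T then turn d' else d')" by (simp add: d'_def)
        with that bk show ?thesis
          by (cases s rule: path.cases) (auto simp: row_path_def col_path_def simp del: step.simps intro!: zigzag_next)
      qed
      ultimately show ?thesis using k South by simp
    qed
  qed
qed

lemma active_valid: "active s \<Longrightarrow> s \<in> {East} \<times> {1..n} \<union> {South} \<times> {1..m}"
  by (cases s rule: path.cases) (auto simp: active_def)

text \<open>The right ends of the staircase rows are taken by trivial pipes, so an active pipe leaves the diagram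
at a border step. The label of the step at which box \<open>(i, j)\<close> would be entered is
\<open>i - j + 1\<close> for a row and \<open>i - j\<close> for a column, which matches \<open>place\<close> read from the northeast.\<close>

lemma active_path_end:
  assumes "active s"
  defines "y \<equiv> end_label T (path s)"
  shows "1 \<le> y" "y \<le> int n" "frontier n m (int n + 1 - y) = label s"
proof -
  obtain d0 k0 b0 where p: "path s = zigzag T d0 b0" "s = (d0, k0)" "b0 = (k0, if d0 = East then 1 else k0)"
    by (cases s rule: path.cases) (auto simp: row_path_def col_path_def)
  obtain d i j where l: "last (path s) = (d, i, j)" by (cases "last (path s)")
  have out: "(i, j) \<notin> boxes T" using zigzag_last[of T d0 b0] l p by simp
  have "path s \<noteq> []" using zigzag_last[of T d0 b0] p by simp
  from last_in_set[OF this] have mem: "(d, i, j) \<in> set (path s)" using l by simp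
  note src = source_along_path[OF mem active_valid[OF assms(1)]]
  have prev: "(d, i, j) = (d0, b0) \<or> (\<exists>b'\<in>boxes T. (i, j) = step d b')"
    using zigzag_previous[of d "(i, j)" T d0 b0] mem p by simp
  have "1 \<le> y \<and> y \<le> int n \<and> frontier n m (int n + 1 - y) = label s"
  proof (cases d)
    case East
    have k: "1 \<le> i \<and> i \<le> n \<and> ((i, j - 1) \<in> boxes T \<and> 1 < j \<or> j = 1)"
    proof (cases "(d, i, j) = (d0, b0)")
      case True
      then show ?thesis using East p active_valid[OF assms(1)]
by auto
    next
      case False
      then show ?thesis using prev East box_range by fastforce
    qed
    have i: "m < i"
    proof (rule ccontr)
      assume "\<not> m < i"
      \<comment> \<open>The pipe would leave at the right end of a staircase row and hence be trivial.\<close>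
      then have "j = i + 1" using k out by (auto simp: box_staircase)
      then have "s = (if (i, i) \<in> ones T then (South, i) else (East, i))"
        using trivial_source[of i j] \<open>\<not> m < i\<close> k src East by simp
      then show False using assms(1) \<open>\<not> m < i\<close> by (auto simp: active_def split: if_splits)
    qed
    have j: "j = parts T ! (i - m - 1) + 1" using k out i by (auto simp: box_below)
    then have y: "y = int i - int j + 1"
      using l East i k by (simp add: y_def end_label_def row_label_below)
    have "1 \<le> y" "y \<le> int n"
      using row_label_range[of i] i k l East by (auto simp: y_def end_label_def)
    moreover have "frontier n m (place East i j) = label (source East i j)"
      using i k j out parts_le[of "i - m - 1"] by (intro final_frontier_outside) (auto simp: n_eq)
    moreover have "int n + 1 - y = place East i j" using y by simp
    ultimately show ?thesis using src East by metis
  next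
    case South
    have k: "(i - 1, j) \<in> boxes T \<and> 1 < i"
    proof (cases "(d, i, j) = (d0, b0)")
      case True
      then show ?thesis using South p active_valid[OF assms(1)] out
by (auto simp: box_staircase)
    next
      case False
      then show ?thesis using prev South box_range by fastforce
    qed
    note r = box_range[of "i - 1" j]
    have i: "m < i"
    proof (rule ccontr)
      assume "\<not> m < i"
      then show False using k r out box_staircase[of i j] by auto
    qed
    have "height j < i - m" using i k r out by (intro height_less) auto
    moreover have "i - m - 1 \<le> height j"
      using height_ge[of "i - m - 1" j] k i by (cases "i = m + 1") auto
    ultimately have "col_label T j = int i - int j"
      using k r i by (simp add: col_label_eq)
    then have y: "y = int i - int j"
      using l South by (simp add: y_def end_label_def)
    have "1 \<le> y" "y \<le> int n"
      using col_label_range[of j] k r l South by (auto simp: y_def end_label_def)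
    moreover have "frontier n m (place South i j) = label (source South i j)"
      using i k r out by (intro final_frontier_outside) auto
    moreover have "int n + 1 - y = place South i j" using y by simp
    ultimately show ?thesis using src South by metis
  qed
  then show "1 \<le> y" "y \<le> int n" "frontier n m (int n + 1 - y) = label s" by auto
qed

lemma final_frontier_trivial:
  assumes "1 \<le> i" "i \<le> m"
  shows "frontier n m (int n + int m + 1 - int i) = (if (i, i) \<in> ones T then col_label T i else - col_label T i)"
proof -
  have i: "i \<le> n" using assms n_eq by simp
  have "frontier n m (int n + int m + 1 - int i) = label (source East i (m + 1))"
    using assms i by (cases "i = n") (auto simp: frontier_def Let_def)
  then show ?thesis using assms trivial_source[of i "m + 1"] by (simp add: row_label_staircase)
qed

lemma zeta_active:
  assumes "active s"
  shows "zeta T (label s) = end_label T (path s)"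
proof -
  have sz: "size_of T = n" using PT by (simp add: PT_B_def)
  have zp: "zeta_pos T (col_label T j) = (if (j, j) \<notin> ones T then end_label T (col_path T j)
      else - end_label T (row_path T j))" if j: "j \<in> {1..m}" for j
  proof -
    have "col_label T j \<noteq> row_label T i" if "i \<in> {1..n}" for i
      using row_col_label[of i j] that j by fastforce
    then have "col_label T j \<notin> row_label T ` {1..size_of T}" unfolding sz by blast
    moreover have "row_with_label T (- col_label T j) = j"
      using row_with_label[of j] j n_eq by (simp add: row_label_staircase)
    ultimately show ?thesis using col_with_label[OF j] by (simp add: zeta_pos_def Let_def)
  qed
  obtain d k where s: "s = (d, k)" by (cases s)
  show ?thesis
  proof (cases d)
    case South
    then have k: "k \<in> {1..m}" "(k, k) \<notin> ones T" using assms s by (auto simp: active_def)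
    then show ?thesis using zp[OF k(1)] col_label_range[of k] s South by (simp add: zeta_def sz)
  next
    case East
    then have k: "k \<in> {1..n}" "k \<le> m \<Longrightarrow> (k, k) \<in> ones T" using assms s by (auto simp: active_def)
    show ?thesis
    proof (cases "k \<le> m")
      case True
      then show ?thesis using k zp[of k] col_label_range[of k] s East
        by (simp add: zeta_def sz row_label_staircase)
    next
      case False
      then have "row_label T k \<in> {1..int n}" using k row_label_range[of k] by auto
      then show ?thesis using k s East row_with_label[of k] by (simp add: zeta_def zeta_pos_def sz)
    qed
  qed
qed

section \<open>Comparing the two counts\<close>

text \<open>The label of the active one among the pipes of row \<open>- c\<close> and column \<open>c\<close>, where \<open>c\<close> is the label of
column \<open>i\<close>.\<close>

definition diag_label :: "nat \<Rightarrow> int" where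
  "diag_label i = (if (i, i) \<in> ones T then - col_label T i else col_label T i)"

definition above_ones :: "(nat \<times> nat) set" where
  "above_ones = {(i, j) \<in> above. (i, i) \<in> ones T}"

lemma finite_above_ones: "finite above_ones"
  using finite_above by (rule finite_subset[rotated]) (auto simp: above_ones_def)

text \<open>Column labels decrease from left to right, so the sum of two \<open>diag_label\<close>s has the sign of the one
further left; it is negative iff the diagonal there contains 1.\<close>

lemma card_diag_pairs:
  "card {(i, j). i \<in> {1..m} \<and> j \<in> {1..m} \<and> diag_label i + diag_label j < 0} =
   2 * card above_ones + card {i \<in> {1..m}. diag_label i < 0}"
proof -
  let ?N = "{i \<in> {1..m}. diag_label i < 0}"
  have neg: "diag_label i < 0 \<longleftrightarrow> (i, i) \<in> ones T" if "i \<in> {1..m}" for i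
    using that col_label_range[of i] by (auto simp: diag_label_def)
  have sum: "diag_label i + diag_label j < 0 \<longleftrightarrow> (i, i) \<in> ones T"
    if "i \<in> {1..m}" "j \<in> {1..m}" "i < j" for i j
    using that col_label_range[of i] col_label_range[of j] col_label_strict[of i j]
    by (auto simp: diag_label_def)
  have "{(i, j). i \<in> {1..m} \<and> j \<in> {1..m} \<and> i \<le> j \<and> diag_label i + diag_label j < 0} =
    above_ones \<union> (\<lambda>i. (i, i)) ` ?N" (is "?P = _")
  proof (intro set_eqI)
    fix p :: "nat \<times> nat"
    obtain i j where p: "p = (i, j)" by (cases p)
    consider "i < j" | "i = j" | "j < i" by linarith
    then show "p \<in> ?P \<longleftrightarrow> p \<in> above_ones \<union> (\<lambda>i. (i, i)) ` ?N"
      using p sum[of i j] by cases (auto simp: above_ones_def above_def)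
  qed
  then have "card ?P = card above_ones + card ((\<lambda>i. (i, i)) ` ?N)"
    using finite_above_ones by (simp, intro card_Un_disjoint) (auto simp: above_ones_def above_def)
  also have "card ((\<lambda>i. (i, i)) ` ?N) = card ?N" by (intro card_image) (auto simp: inj_on_def)
  finally show ?thesis using card_pairs_split[of "{1..m}" diag_label] by simp
qed

lemma crossing_sign_above: "b \<in> above \<Longrightarrow> crossing_sign b = (if b \<in> above_ones then 1 else - 1)"
proof -
  assume b: "b \<in> above"
  obtain i j where ij: "b = (i, j)" by (cases b)
  have "source East i j = (if (i, i) \<in> ones T then (South, i) else (East, i))" "source South i j = (South, j)"
    using b ij trivial_source[of i j] South_above[of i j] by (auto simp: above_def)
  then show ?thesis using b ij by (auto simp: crossing_sign_def above_ones_def)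
qed

lemma sum_crossing_sign_above: "int (card above) + (\<Sum>b\<in>above. crossing_sign b) = 2 * int (card above_ones)"
proof -
  have "(\<Sum>b\<in>above. crossing_sign b) = (\<Sum>b\<in>above. 2 * (if b \<in> above_ones then 1 else 0) - 1)"
    by (intro sum.cong) (auto simp: crossing_sign_above)
  also have "\<dots> = 2 * (\<Sum>b\<in>above. if b \<in> above_ones then 1 else 0) - int (card above)"
    by (simp add: sum_subtractf sum_distrib_left)
  also have "(\<Sum>b\<in>above. if b \<in> above_ones then 1 else (0::int)) = int (card (above \<inter> above_ones))"
    using finite_above by (simp add: sum.If_cases)
  also have "above \<inter> above_ones = above_ones" by (auto simp: above_ones_def)
  finally show ?thesis by simp
qed

text \<open>Translates membership in zigzag paths, which defines the statistics, into the kind of the source.\<close>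

lemma mem_row_path:
  assumes "(i, j) \<in> boxes T"
  shows "(\<exists>k\<in>{1..n}. (d, i, j) \<in> set (row_path T k)) \<longleftrightarrow> fst (source d i j) = East"
    and "(\<exists>k\<in>{1..m}. (d, i, j) \<in> set (col_path T k)) \<longleftrightarrow> fst (source d i j) = South"
proof -
  note r = box_range[OF assms]
  have v: "source d i j \<in> {East} \<times> {1..n} \<union> {South} \<times> {1..m}"
    using r by (intro source_valid; simp)
  have p: "(d, i, j) \<in> set (path (source d i j))" by (rule path_of_source[OF assms])
  have rowD: "source d i j = (East, k)" if "(d, i, j) \<in> set (row_path T k)" "k \<in> {1..n}" for k
    using that by (intro source_along_path) auto
  have colD: "source d i j = (South, k)" if "(d, i, j) \<in> set (col_path T k)" "k \<in> {1..m}" for k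
    using that by (intro source_along_path) auto
  show "(\<exists>k\<in>{1..n}. (d, i, j) \<in> set (row_path T k)) \<longleftrightarrow> fst (source d i j) = East"
  proof
    assume "fst (source d i j) = East"
    then obtain k where "source d i j = (East, k)" "k \<in> {1..n}" using v by (cases "source d i j") auto
    then show "\<exists>k\<in>{1..n}. (d, i, j) \<in> set (row_path T k)" using p by auto
  qed (use rowD in fastforce)
  show "(\<exists>k\<in>{1..m}. (d, i, j) \<in> set (col_path T k)) \<longleftrightarrow> fst (source d i j) = South"
  proof
    assume "fst (source d i j) = South"
    then obtain k where "source d i j = (South, k)" "k \<in> {1..m}" using v by (cases "source d i j") auto
    then show "\<exists>k\<in>{1..m}. (d, i, j) \<in> set (col_path T k)" using p by auto
  qed (use colD in fastforce)
qed

text \<open>A 0 contributes \<open>1 + 1\<close> if its two pipes are of the same kind and \<open>1 - 1\<close> otherwise; a 1 contributes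
just the 1 of its box.\<close>

lemma sum_crossing_sign_zeros:
  "int (card (boxes T)) + (\<Sum>b\<in>zeros T. crossing_sign b) = int (2 * (zero_EE T + zero_NN T) + one T)"
proof -
  have sz: "size_of T = n" using PT by (simp add: PT_B_def)
  have fin: "finite (zeros T)" using finite_boxes by (simp add: zeros_def)
  let ?type = "\<lambda>d (i, j). fst (source d i j)"
  let ?E = "{b \<in> zeros T. ?type East b = East \<and> ?type South b = East}"
  let ?N = "{b \<in> zeros T. ?type East b = South \<and> ?type South b = South}"
  have row: "(\<exists>k\<in>{1..n}. (d, b) \<in> set (row_path T k)) \<longleftrightarrow> ?type d b = East"
    and col: "(\<exists>k\<in>{1..m}. (d, b) \<in> set (col_path T k)) \<longleftrightarrow> ?type d b = South"
    if "b \<in> zeros T" for d b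
    using that mem_row_path[of "fst b" "snd b" d] by (auto simp: zeros_def split: prod.splits)
  have EE: "zero_EE T = card ?E" and NN: "zero_NN T = card ?N"
    unfolding zero_EE_def zero_NN_def sz using row col
    by (auto intro!: arg_cong[of _ _ card] cong: conj_cong)
  \<comment> \<open>The zeros at which both pipes are of the same kind.\<close>
  define G where "G = ?E \<union> ?N"
  have "crossing_sign b = 2 * (if b \<in> G then 1 else 0) - 1" if "b \<in> zeros T" for b
    using that by (cases b; cases "?type East b"; cases "?type South b") (auto simp: crossing_sign_def G_def)
  then have "(\<Sum>b\<in>zeros T. crossing_sign b) = (\<Sum>b\<in>zeros T. 2 * (if b \<in> G then 1 else 0) - 1)"
    by (intro sum.cong) auto
  also have "\<dots> = 2 * (\<Sum>b\<in>zeros T. if b \<in> G then 1 else 0) - int (card (zeros T))"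
    by (simp add: sum_subtractf sum_distrib_left)
  also have "(\<Sum>b\<in>zeros T. if b \<in> G then 1 else (0::int)) = int (card (zeros T \<inter> G))"
    using fin by (simp add: sum.If_cases)
  also have "zeros T \<inter> G = ?E \<union> ?N" by (auto simp: G_def)
  also have "card (?E \<union> ?N) = zero_EE T + zero_NN T"
    unfolding EE NN using fin by (intro card_Un_disjoint) auto
  finally have "(\<Sum>b\<in>zeros T. crossing_sign b) = 2 * int (zero_EE T + zero_NN T) - int (card (zeros T))" .
  moreover have "card (boxes T) = one T + card (zeros T)"
    using ones_boxes finite_boxes card_Diff_subset[of "ones T" "boxes T"] card_mono[of "boxes T" "ones T"]
    by (simp add: one_def zeros_def finite_subset)
  ultimately show ?thesis by simp
qed

lemma frontier_ascents_statistics: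
  assumes "1 \<le> n"
  shows "frontier_ascents n m = int (2 * (zero_EE T + zero_NN T) + one T) + 2 * int (card above_ones)"
proof -
  have "card (boxes T \<union> above) = card (boxes T) + card above"
    using finite_boxes finite_above box_range
    by (intro card_Un_disjoint) (force simp: above_def)+
  moreover have "(\<Sum>b\<in>straight. crossing_sign b) = (\<Sum>b\<in>zeros T. crossing_sign b) + (\<Sum>b\<in>above. crossing_sign b)"
    unfolding straight_def using finite_boxes finite_above zeros_above_disjoint
    by (intro sum.union_disjoint) (auto simp: zeros_def)
  ultimately show ?thesis
    using frontier_ascents_total[OF assms] frontier_ascents_start[OF assms] sum_crossing_sign_above sum_crossing_sign_zeros by simp
qed

lemma active_diag_label:
  assumes "i \<in> {1..m}"
  obtains s where "active s" "label s = diag_label i"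
proof (cases "(i, i) \<in> ones T")
  case True
  moreover have "i \<in> {1..n}" using assms n_eq by auto
  ultimately have "active (East, i)" "label (East, i) = diag_label i"
    using assms by (auto simp: active_def diag_label_def row_label_staircase)
  then show ?thesis by (rule that)
next
  case False
  then have "active (South, i)" "label (South, i) = diag_label i"
    using assms by (auto simp: active_def diag_label_def)
  then show ?thesis by (rule that)
qed

lemma final_frontier_top: "i \<in> {1..m} \<Longrightarrow> frontier n m (int n + int m + 1 - int i) = - diag_label i"
  using final_frontier_trivial[of i] by (simp add: diag_label_def)

context
  assumes signed: "zeta T \<in> signed_perms n"
begin

abbreviation "\<tau> \<equiv> inv (zeta T)"

lemma inverse_zeta_active:
  assumes "active s"
  shows "\<exists>y\<in>{1..int n}. \<tau> y = label s \<and> y = zeta T (label s)"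
proof -
  have "\<tau> (zeta T (label s)) = label s"
    using permutes_inverses(2)[OF signed_permsD(1)[OF signed]] by simp
  moreover have "zeta T (label s) \<in> {1..int n}"
    using zeta_active[OF assms] active_path_end[OF assms] by simp
  ultimately show ?thesis by blast
qed

text \<open>The absolute value of \<open>\<tau> y\<close> labels a row or a column. Its sign is that of the corresponding active
label \<open>x\<close>, because \<open>\<zeta>\<close> maps \<open>x\<close> to a positive value and \<open>- x\<close> to a negative one.\<close>

lemma inverse_zeta_cases:
  assumes y: "y \<in> {1..int n}"
  obtains (below) i where "m < i" "i \<le> n" "\<tau> y = row_label T i"
  | (diag) i where "i \<in> {1..m}" "\<tau> y = diag_label i"
proof -
  have \<tau>: "\<tau> \<in> signed_perms n" by (rule signed_perm_inverse(1)[OF signed])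
  define x where "x = \<tau> y"
  have zx: "zeta T x = y"
    using permutes_inverses(1)[OF signed_permsD(1)[OF signed]] by (simp add: x_def)
  have x: "x \<in> pm_set n" using signed_permsD(3)[OF \<tau>, of y] y by (auto simp: pm_set_def x_def)
  have pos: "x = label s" if "active s" "x = label s \<or> x = - label s" for s
  proof (rule ccontr)
    assume "x \<noteq> label s"
    then have "label s = - x" using that by auto
    then have "zeta T (label s) = - y" using signed_permsD(2)[OF signed x] zx by simp
    moreover have "zeta T (label s) \<ge> 1" using inverse_zeta_active[OF that(1)] by auto
    ultimately show False using y by simp
  qed
  have "\<bar>x\<bar> \<in> {1..int n}" using x by (auto simp: pm_set_def)
  then consider i where "i \<in> {m<..n}" "\<bar>x\<bar> = row_label T i" | i where "i \<in> {1..m}" "\<bar>x\<bar> = col_label T i"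
    unfolding labels_onto by blast
  then show ?thesis
  proof cases
    case 1
    then have "active (East, i)" by (auto simp: active_def)
    moreover have "x = row_label T i \<or> x = - row_label T i" using 1(2) by linarith
    ultimately have "x = row_label T i" using pos[of "(East, i)"] by simp
    then show ?thesis using 1 below by (auto simp: x_def)
  next
    case 2
    obtain s where s: "active s" "label s = diag_label i" by (rule active_diag_label[OF 2(1)])
    have "x = diag_label i \<or> x = - diag_label i" using 2(2) unfolding diag_label_def by auto
    then have "x = diag_label i" using pos[OF s(1)] s(2) by simp
    then show ?thesis using 2 diag by (auto simp: x_def)
  qed
qed

lemma final_frontier_low:
  assumes y: "y \<in> {1..int n}"
  shows "frontier n m (int n + 1 - y) = \<tau> y"
proof -
  have "\<exists>s. active s \<and> \<tau> y = label s"
  proof (cases rule: inverse_zeta_cases[OF y])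
    case (1 i)
    then have "active (East, i)" "\<tau> y = label (East, i)" by (auto simp: active_def)
    then show ?thesis by blast
  next
    case (2 i)
    then show ?thesis using active_diag_label[OF 2(1)] by metis
  qed
  then obtain s where s: "active s" "\<tau> y = label s" by blast
  have "zeta T (label s) = y"
    using s permutes_inverses(1)[OF signed_permsD(1)[OF signed], of y] by simp
  then show ?thesis using s zeta_active[OF s(1)] active_path_end(3)[OF s(1)] by simp
qed

text \<open>The values \<open>\<tau> y\<close> other than the \<open>diag_label\<close> are positive, so a negative sum involves some
\<open>diag_label\<close>. The left-hand side counts a pair of two distinct \<open>diag_label\<close>s in both orders, the first
term on the right only once; \<open>card above_ones\<close> is the number of these pairs.\<close>

lemma card_mixed_pairs:
  "card {(y, i). y \<in> {1..int n} \<and> i \<in> {1..m} \<and> \<tau> y + diag_label i < 0} =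
   card {(i, j). i \<in> {1..int n} \<and> j \<in> {1..int n} \<and> i \<le> j \<and> \<tau> i + \<tau> j < 0} + card above_ones"
proof -
  let ?S = "{1..int n}"
  let ?g = "\<lambda>i. zeta T (diag_label i)"
  let ?Y = "?g ` {1..m}"
  have g: "?g i \<in> ?S" "\<tau> (?g i) = diag_label i" if i: "i \<in> {1..m}" for i
  proof -
    obtain s where s: "active s" "label s = diag_label i" by (rule active_diag_label[OF i])
    show "?g i \<in> ?S" "\<tau> (?g i) = diag_label i" using inverse_zeta_active[OF s(1)] s(2) by auto
  qed
  have "diag_label i \<noteq> diag_label j" if "i \<in> {1..m}" "j \<in> {1..m}" "i < j" for i j
    using that col_label_strict[of i j] col_label_range[of i] col_label_range[of j]
    by (auto simp: diag_label_def)
  then have inj_diag: "inj_on diag_label {1..m}"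
    by (intro linorder_inj_onI) auto
  have inj: "inj_on ?g {1..m}"
    using inj_diag g(2) by (intro inj_onI) (metis inj_onD)
  have pos: "0 < \<tau> y" if "y \<in> ?S - ?Y" for y
  proof -
    have y: "y \<in> ?S" using that by simp
    show ?thesis
    proof (cases rule: inverse_zeta_cases[OF y])
      case (1 i)
      then show ?thesis using row_label_range[of i] by simp
    next
      case (2 i)
      then have "y = ?g i"
        using permutes_inverses(1)[OF signed_permsD(1)[OF signed], of y] by simp
      then show ?thesis using that 2 by blast
    qed
  qed
  have Y: "?Y \<subseteq> ?S" using g by blast
  have "bij_betw (\<lambda>(y, i). (y, ?g i)) {(y, i). y \<in> ?S \<and> i \<in> {1..m} \<and> \<tau> y + diag_label i < 0}
      {(x, y). x \<in> ?S \<and> y \<in> ?Y \<and> \<tau> x + \<tau> y < 0}"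
    unfolding bij_betw_def using inj g(2)
    by (auto simp: inj_on_def image_iff simp del: atLeastAtMost_iff)
  note b1 = bij_betw_same_card[OF this]
  have "bij_betw (\<lambda>(i, j). (?g i, ?g j)) {(i, j). i \<in> {1..m} \<and> j \<in> {1..m} \<and> diag_label i + diag_label j < 0}
      {(x, y). x \<in> ?Y \<and> y \<in> ?Y \<and> \<tau> x + \<tau> y < 0}"
    unfolding bij_betw_def using inj g(2)
    by (auto simp: inj_on_def image_iff simp del: atLeastAtMost_iff)
  note b2 = bij_betw_same_card[OF this]
  have "{y \<in> ?S. \<tau> y < 0} = ?g ` {i \<in> {1..m}. diag_label i < 0}"
    using pos g by (fastforce simp del: atLeastAtMost_iff)
  moreover have "inj_on ?g {i \<in> {1..m}. diag_label i < 0}" using inj by (rule inj_on_subset) auto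
  ultimately have b3: "card {y \<in> ?S. \<tau> y < 0} = card {i \<in> {1..m}. diag_label i < 0}"
    by (simp only: card_image)
  have "card {(x, y). x \<in> ?S \<and> y \<in> ?S \<and> \<tau> x + \<tau> y < 0} +
      card {(x, y). x \<in> ?Y \<and> y \<in> ?Y \<and> \<tau> x + \<tau> y < 0} =
    2 * card {(x, y). x \<in> ?S \<and> y \<in> ?Y \<and> \<tau> x + \<tau> y < 0}"
    using Y by (intro card_pairs_subset) (auto intro: less_imp_le[OF pos])
  moreover have "finite ?S" by simp
  note card_pairs_split[OF this, of \<tau>]
  ultimately show ?thesis using b1 b2 b3 card_diag_pairs by linarith
qed

text \<open>The three sets of ascents are those within the first \<open>n\<close> positions, those from the first \<open>n\<close> to the
last \<open>m\<close> positions, and those within the last \<open>m\<close> positions.\<close>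

lemma frontier_ascents_inv: "frontier_ascents n m = int (inv_B n \<tau>) + 2 * int (card above_ones)"
proof -
  let ?S = "{1..int n}"
  let ?W = "frontier n m"
  let ?low = "\<lambda>y. int n + 1 - y" and ?top = "\<lambda>i. int n + int m + 1 - int i"
  let ?A = "(\<lambda>(i, j). (?low j, ?low i)) ` ascents ?S (\<lambda>i. - \<tau> i)"
  let ?B = "(\<lambda>(y, i). (?low y, ?top i)) ` {(y, i). y \<in> ?S \<and> i \<in> {1..m} \<and> \<tau> y + diag_label i < 0}"
  let ?C = "(\<lambda>(i, j). (?top j, ?top i)) ` above_ones"
  have low: "?W (?low y) = \<tau> y" if "y \<in> ?S" for y using final_frontier_low[OF that] .
  have top: "?W (?top i) = - diag_label i" if "i \<in> {1..m}" for i using final_frontier_top[OF that] .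
  have dom: "(i, j) \<in> above_ones \<longleftrightarrow> diag_label i < diag_label j"
    if "i \<in> {1..m}" "j \<in> {1..m}" "i < j" for i j
    using that col_label_strict[of i j] col_label_range[of i] col_label_range[of j]
    by (auto simp: above_ones_def above_def diag_label_def)
  have asc: "ascents positions ?W = ?A \<union> (?B \<union> ?C)"
  proof (intro set_eqI iffI)
    fix p assume "p \<in> ascents positions ?W"
    then obtain a b where p: "p = (a, b)" "a \<in> positions" "b \<in> positions" "a < b" "?W a < ?W b"
      by (auto simp: ascents_def)
    consider "b \<le> int n" | "a \<le> int n" "int n < b" | "int n < a" using p by linarith
    then show "p \<in> ?A \<union> (?B \<union> ?C)"
    proof cases
      case 1
      then have "(?low b, ?low a) \<in> ascents ?S (\<lambda>i. - \<tau> i)"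
        using p low[of "?low a"] low[of "?low b"] by (auto simp: ascents_def)
      moreover have "p = (\<lambda>(i, j). (?low j, ?low i)) (?low b, ?low a)" using p by simp
      ultimately show ?thesis by blast
    next
      case 2
      let ?i = "nat (int n + int m + 1 - b)"
      have i: "?i \<in> {1..m}" "?top ?i = b" using 2 p by auto
      then have "\<tau> (?low a) + diag_label ?i < 0"
        using p 2 low[of "?low a"] top[of ?i] by auto
      then have "(?low a, ?i) \<in> {(y, i). y \<in> ?S \<and> i \<in> {1..m} \<and> \<tau> y + diag_label i < 0}"
        using i 2 p by auto
      moreover have "p = (\<lambda>(y, i). (?low y, ?top i)) (?low a, ?i)" using p i by simp
      ultimately show ?thesis by blast
    next
      case 3
      let ?i = "nat (int n + int m + 1 - b)" and ?j = "nat (int n + int m + 1 - a)"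
      have ij: "?i \<in> {1..m}" "?top ?i = b" "?j \<in> {1..m}" "?top ?j = a" "?i < ?j"
        using 3 p by auto
      then have "diag_label ?i < diag_label ?j" using p top[of ?i] top[of ?j] by simp
      then have "(?i, ?j) \<in> above_ones" using dom ij by blast
      moreover have "p = (\<lambda>(i, j). (?top j, ?top i)) (?i, ?j)" using p ij by simp
      ultimately show ?thesis by blast
    qed
  next
    fix p assume "p \<in> ?A \<union> (?B \<union> ?C)"
    then consider i j where "p = (?low j, ?low i)" "i \<in> ?S" "j \<in> ?S" "i < j" "\<tau> j < \<tau> i"
      | y i where "p = (?low y, ?top i)" "y \<in> ?S" "i \<in> {1..m}" "\<tau> y + diag_label i < 0"
      | i j where "p = (?top j, ?top i)" "(i, j) \<in> above_ones"
      by (auto simp: ascents_def)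
    then show "p \<in> ascents positions ?W"
    proof cases
      case 1
      then show ?thesis using low[of i] low[of j] by (auto simp: ascents_def)
    next
      case 2
      then show ?thesis using low[of y] top[of i] by (auto simp: ascents_def)
    next
      case 3
      then have "i \<in> {1..m}" "j \<in> {1..m}" "i < j" by (auto simp: above_ones_def above_def)
      then show ?thesis using 3 dom[of i j] top[of i] top[of j] by (auto simp: ascents_def)
    qed
  qed
  have fin: "finite ?A" "finite ?B" "finite ?C"
    using finite_above_ones finite_ascents[of ?S]
    by (auto intro!: finite_imageI intro: finite_subset[of _ "?S \<times> {1..m}"])
  \<comment> \<open>The pieces are disjoint since positions are at most \<open>n\<close> in \<open>low\<close> and above \<open>n\<close> in \<open>top\<close>.\<close>
  have "card (ascents positions ?W) = card ?A + (card ?B + card ?C)"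
    unfolding asc using fin
    by (subst card_Un_disjoint, simp, simp, force simp: ascents_def above_ones_def above_def,
        subst card_Un_disjoint) (auto simp: above_ones_def above_def)
  also have "card ?A = card (ascents ?S (\<lambda>i. - \<tau> i))"
    by (intro card_image) (auto simp: inj_on_def)
  also have "card ?B = card {(y, i). y \<in> ?S \<and> i \<in> {1..m} \<and> \<tau> y + diag_label i < 0}"
    by (intro card_image) (auto simp: inj_on_def)
  also have "card ?C = card above_ones"
    by (intro card_image) (auto simp: inj_on_def)
  finally show ?thesis
    using card_mixed_pairs inv_B_signed[OF signed_perm_inverse(1)[OF signed]] by (simp add: frontier_ascents_def)
qed

lemma inv_B_zeta:
  assumes "1 \<le> n"
  shows "inv_B n (zeta T) = 2 * (zero_EE T + zero_NN T) + one T"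
  using frontier_ascents_inv frontier_ascents_statistics[OF assms] signed_perm_inverse(2)[OF signed] by simp

end

end

theorem theorem4p7:
  fixes n :: nat and \<sigma> :: "int \<Rightarrow> int"
  assumes "n \<ge> 1" and "\<sigma> \<in> signed_perms n"
  shows "length_B n \<sigma> = inv_B n \<sigma> \<and>
    (\<forall>T\<in>PT_B n. zeta T = \<sigma> \<longrightarrow>
       inv_B n \<sigma> = 2 * (zero_EE T + zero_NN T) + one T)"
proof (intro conjI ballI impI)
  show "length_B n \<sigma> = inv_B n \<sigma>" using assms(2) by (rule length_B_eq_inv_B)
next
  fix T assume T: "T \<in> PT_B n" "zeta T = \<sigma>"
  then interpret tableau_B T n by unfold_locales
  show "inv_B n \<sigma> = 2 * (zero_EE T + zero_NN T) + one T"
    using inv_B_zeta assms T(2) by simp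
qed

end
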